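(* Suppose that the Robinson constraint qualification (RCQ) holds at a locally optimal solution $\bar x$ of the problem $\mathrm{P}(0,0)$ (i.e. $\min f(x)$ s.t. $G(x)\in\mathcal{K}$), where $\mathcal{K}$ is $C^2$-cone reducible, and that Robinson's second order sufficient condition $$\inf_{y\in M(\bar x,0,0)}\left\{\langle d,\nabla^2_{xx}L(\bar x;y)d\rangle-\sigma\left(y,\mathcal{T}^2_{\mathcal{K}}(G(\bar x),G'(\bar x)d)\right)\right\}>0\qquad\forall\,d\in\mathcal{C}(\bar x)\setminus\{0\}$$ holds at $\bar x$. Then there exists an open neighborhood $\mathcal{V}$ of $\bar x$ such that the set-valued mapping $X_{\mathrm{KKT}}\cap\mathcal{V}$ is continuous at $(0,0,\bar x)$.
   Context: Setting. $\mathcal{X},\mathcal{Y}$ are finite dimensional real Euclidean spaces, $f:\mathcal{X}\to\mathbb{R}$ and $G:\mathcal{X}\to\mathcal{Y}$ are twice continuously differentiable, and $\mathcal{K}\subset\mathcal{Y}$ is a nonempty closed convex set. For $(a,b)\in\mathcal{X}\times\mathcal{Y}$, $\mathrm{P}(a,b)$ is the problem $\min f(x)-\langle a,x\rangle$ s.t. $G(x)+b\in\mathcal{K}$. $C^2$-cone reducibility (standing assumption on $\mathcal{K}$): for every $\overline A\in\mathcal{K}$ there exist an open neighborhood $\mathcal{W}\subset\mathcal{Y}$ of $\overline A$, a pointed closed convex cone $\mathcal{Q}$ (pointed: its lineality space is $\{0\}$) in a finite dimensional space $\mathcal{Z}$, and a twice continuously differentiable $\Xi:\mathcal{W}\to\mathcal{Z}$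 such that $\Xi(\overline A)=0$, $\Xi'(\overline A):\mathcal{Y}\to\mathcal{Z}$ is onto, and $\mathcal{K}\cap\mathcal{W}=\{A\in\mathcal{W}\mid\Xi(A)\in\mathcal{Q}\}$. KKT system. $L(x;y):=f(x)+\langle y,G(x)\rangle$, so $\nabla_xL(x;y)=\nabla f(x)+G'(x)^*y$; $\nabla^2_{xx}L(\bar x;y)$ is the Hessian of $L(\cdot;y)$ at $\bar x$. $\mathcal{N}_{\mathcal{K}}(z)$ is the normal cone of convex analysis. $S_{\mathrm{KKT}}(a,b)$ is the set of all $(x,y)$ with $a=\nabla_xL(x;y)$ and $y\in\mathcal{N}_{\mathcal{K}}(G(x)+b)$ (in particular $G(x)+b\in\mathcal{K}$); $M(x,a,b):=\{y\mid(x,y)\in S_{\mathrm{KKT}}(a,b)\}$; $X_{\mathrm{KKT}}(a,b):=\{x\mid\exists y,\ (x,y)\in S_{\mathrm{KKT}}(a,b)\}$ is the set of stationary points. $X_{\mathrm{KKT}}\cap\mathcal{V}$ denotes the set-valued mapping $(a,b)\mapsto X_{\mathrm{KKT}}(a,b)\cap\mathcal{V}$. Tangent sets. $\mathcal{T}_{\mathcal{K}}(z):=\{d\mid\exists z^k\to z,\ z^k\in\mathcal{K},\ t^k\downarrow0,\ (z^k-z)/t^k\to d\}$. $\mathcal{T}^2_{\mathcal{K}}(z,h):=\{w\in\mathcal{Y}\mid\exists t_k\downarrow0\text{ such that }\mathrm{dist}(z+t_kh+\tfrac12t_k^2w,\mathcal{K})=o(t_k^2)\}$. $\sigma(y,Z):=\sup\{\langle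 y,z\rangle\mid z\in Z\}$. Conditions at a feasible point $\bar x$ of $\mathrm{P}(0,0)$. RCQ: $G'(\bar x)\mathcal{X}+\mathcal{T}_{\mathcal{K}}(G(\bar x))=\mathcal{Y}$. Critical cone: $\mathcal{C}(\bar x):=\{d\in\mathcal{X}\mid G'(\bar x)d\in\mathcal{T}_{\mathcal{K}}(G(\bar x)),\ f'(\bar x)d\le0\}$. Continuity. A set-valued mapping $\Psi:\mathcal{E}\rightrightarrows\mathcal{F}$ with $\bar q\in\Psi(\bar p)$ is lower semi-continuous at $\bar p$ for $\bar q$ if for any open neighborhood $\mathcal{O}$ of $\bar q$ there is an open neighborhood $\mathcal{U}$ of $\bar p$ with $\Psi(p)\cap\mathcal{O}\neq\emptyset$ for all $p\in\mathcal{U}$; it is upper semi-continuous at $\bar p$ if for any open set $\mathcal{O}\supset\Psi(\bar p)$ there is an open neighborhood $\mathcal{U}$ of $\bar p$ with $\Psi(p)\subset\mathcal{O}$ for all $p\in\mathcal{U}$; it is continuous at $(\bar p,\bar q)$ if both hold. *)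

theory Defs
  imports "HOL-Analysis.Analysis" "HOL-Library.Landau_Symbols"
begin

definition C2_on :: "('a::real_normed_vector \<Rightarrow> 'b::real_normed_vector) \<Rightarrow> 'a set \<Rightarrow> bool" where
  "C2_on g S \<longleftrightarrow>
    (\<exists>(g' :: 'a \<Rightarrow> 'a \<Rightarrow>\<^sub>L 'b) (g'' :: 'a \<Rightarrow> 'a \<Rightarrow>\<^sub>L ('a \<Rightarrow>\<^sub>L 'b)).
      (\<forall>x\<in>S. (g has_derivative blinfun_apply (g' x)) (at x)) \<and>
      (\<forall>x\<in>S. (g' has_derivative blinfun_apply (g'' x)) (at x)) \<and>
      continuous_on S g'')"

definition gradient :: "('a::real_inner \<Rightarrow> real) \<Rightarrow> 'a \<Rightarrow> 'a" where
  "gradient g x = (THE v. GDERIV g x :> v)"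

lemma gradient_eqI:
  assumes "GDERIV g x :> v"
  shows "gradient g x = v"
  unfolding gradient_def
proof (rule the_equality)
  show "GDERIV g x :> v" by fact
next
  fix w assume "GDERIV g x :> w"
  with assms have "(\<lambda>h. h \<bullet> w) = (\<lambda>h. h \<bullet> v)"
    unfolding gderiv_def by (intro has_derivative_unique)
  then have "(w - v) \<bullet> w = (w - v) \<bullet> v" by (simp add: fun_eq_iff)
  then have "(w - v) \<bullet> (w - v) = 0" by (subst inner_diff_right) simp
  then show "w = v" by simp
qed

definition hessian :: "('a::real_inner \<Rightarrow> real) \<Rightarrow> 'a \<Rightarrow> 'a \<Rightarrow> 'a" where
  "hessian g x = frechet_derivative (gradient g) (at x)"

definition normal_cone :: "'b::real_inner set \<Rightarrow> 'b \<Rightarrow> 'b set" where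
  "normal_cone K z = (if z \<in> K then {y. \<forall>w\<in>K. y \<bullet> (w - z) \<le> 0} else {})"

text \<open>
  In both tangent sets, \<open>t\<^sub>k \<down> 0\<close> means that the \<open>t\<^sub>k\<close> are positive and tend to \<open>0\<close>;
  requiring them to be decreasing as well would give the same sets, by passing to subsequences.
\<close>

definition tangent_cone :: "'b::real_normed_vector set \<Rightarrow> 'b \<Rightarrow> 'b set" where
  "tangent_cone K z =
    {d. \<exists>(zs :: nat \<Rightarrow> 'b) (t :: nat \<Rightarrow> real).
        zs \<longlonglongrightarrow> z \<and> (\<forall>k. zs k \<in> K) \<and> (\<forall>k. t k > 0) \<and> t \<longlonglongrightarrow> 0 \<and>
        (\<lambda>k. (zs k - z) /\<^sub>R t k) \<longlonglongrightarrow> d}"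

definition second_order_tangent_set :: "'b::real_normed_vector set \<Rightarrow> 'b \<Rightarrow> 'b \<Rightarrow> 'b set" where
  "second_order_tangent_set K z h =
    {w. \<exists>t :: nat \<Rightarrow> real. (\<forall>k. t k > 0) \<and> t \<longlonglongrightarrow> 0 \<and>
        (\<lambda>k. infdist (z + t k *\<^sub>R h + (1/2 * (t k)\<^sup>2) *\<^sub>R w) K) \<in> o(\<lambda>k. (t k)\<^sup>2)}"

text \<open>Extended-real valued; the supremum over the empty set is \<open>-\<infinity>\<close>.\<close>

definition support_function :: "'b::real_inner \<Rightarrow> 'b set \<Rightarrow> ereal" where
  "support_function y Z = (SUP z\<in>Z. ereal (y \<bullet> z))"

text \<open>
  Since \<open>\<Xi>'(A)\<close> maps \<open>'b\<close> onto the space containing the cone, that space has dimension at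
  most \<open>DIM('b)\<close>. It is therefore no restriction to realise it as a linear subspace \<open>Z\<close>
  (possibly \<open>{0}\<close>) of \<open>'b\<close>; this lets it depend on the point \<open>A\<close>.
\<close>

definition C2_cone_reducible_at :: "'b::euclidean_space set \<Rightarrow> 'b \<Rightarrow> bool" where
  "C2_cone_reducible_at K A \<longleftrightarrow>
    (\<exists>(W :: 'b set) (Z :: 'b set) (Q :: 'b set) (\<Xi> :: 'b \<Rightarrow> 'b).
      open W \<and> A \<in> W \<and>
      subspace Z \<and> Q \<subseteq> Z \<and> closed Q \<and> convex Q \<and> cone Q \<and> Q \<inter> uminus ` Q = {0} \<and>
      \<Xi> ` W \<subseteq> Z \<and> C2_on \<Xi> W \<and> \<Xi> A = 0 \<and> range (frechet_derivative \<Xi> (at A)) = Z \<and>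
      K \<inter> W = {B \<in> W. \<Xi> B \<in> Q})"

definition C2_cone_reducible :: "'b::euclidean_space set \<Rightarrow> bool" where
  "C2_cone_reducible K \<longleftrightarrow> (\<forall>A\<in>K. C2_cone_reducible_at K A)"

definition feasible :: "('a \<Rightarrow> 'b::ab_group_add) \<Rightarrow> 'b set \<Rightarrow> 'b \<Rightarrow> 'a set" where
  "feasible G K b = {x. G x + b \<in> K}"

definition locally_optimal ::
  "('a::real_inner \<Rightarrow> real) \<Rightarrow> ('a \<Rightarrow> 'b::ab_group_add) \<Rightarrow> 'b set \<Rightarrow> 'a \<Rightarrow> 'b \<Rightarrow> 'a \<Rightarrow> bool" where
  "locally_optimal f G K a b x \<longleftrightarrow>
    x \<in> feasible G K b \<and>
    (\<exists>U. open U \<and> x \<in> U \<and> (\<forall>u \<in> feasible G K b \<inter> U. f x - a \<bullet> x \<le> f u - a \<bullet> u))"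

definition lagrangian ::
  "('a \<Rightarrow> real) \<Rightarrow> ('a \<Rightarrow> 'b::real_inner) \<Rightarrow> 'a \<Rightarrow> 'b \<Rightarrow> real" where
  "lagrangian f G x y = f x + y \<bullet> G x"

lemma gradient_lagrangian:
  fixes f :: "'a::euclidean_space \<Rightarrow> real" and G :: "'a \<Rightarrow> 'b::euclidean_space"
  assumes f: "f differentiable at x" and G: "G differentiable at x"
  shows "gradient (\<lambda>u. lagrangian f G u y) x =
    gradient f x + adjoint (frechet_derivative G (at x)) y"
proof -
  note f' = f[unfolded frechet_derivative_works] and G' = G[unfolded frechet_derivative_works]
  have G'_lin: "linear (frechet_derivative G (at x))"
    using G' has_derivative_linear by blast
  have f'_lin: "linear (frechet_derivative f (at x))"
    using f' has_derivative_linear by blast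
  have "frechet_derivative f (at x) = (\<lambda>h. h \<bullet> adjoint (frechet_derivative f (at x)) 1)"
    by (rule ext) (simp add: adjoint_works[OF f'_lin])
  then have gf: "GDERIV f x :> adjoint (frechet_derivative f (at x)) 1"
    using f' unfolding gderiv_def by metis
  have "((\<lambda>u. lagrangian f G u y) has_derivative
      (\<lambda>h. h \<bullet> gradient f x + y \<bullet> frechet_derivative G (at x) h)) (at x)"
    unfolding lagrangian_def gradient_eqI[OF gf]
    by (intro has_derivative_add has_derivative_inner_right G' gf[unfolded gderiv_def])
  moreover have "(\<lambda>h. h \<bullet> gradient f x + y \<bullet> frechet_derivative G (at x) h) =
      (\<lambda>h. h \<bullet> (gradient f x + adjoint (frechet_derivative G (at x)) y))"
    by (rule ext)
      (simp only: inner_add_right adjoint_works[OF G'_lin] inner_commute[of y])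
  ultimately have "GDERIV (\<lambda>u. lagrangian f G u y) x :>
      gradient f x + adjoint (frechet_derivative G (at x)) y"
    unfolding gderiv_def by simp
  then show ?thesis by (rule gradient_eqI)
qed

definition S_KKT ::
  "('a::real_inner \<Rightarrow> real) \<Rightarrow> ('a \<Rightarrow> 'b::real_inner) \<Rightarrow> 'b set \<Rightarrow> 'a \<Rightarrow> 'b \<Rightarrow> ('a \<times> 'b) set" where
  "S_KKT f G K a b =
    {(x, y). a = gradient (\<lambda>u. lagrangian f G u y) x \<and> y \<in> normal_cone K (G x + b)}"

definition multipliers ::
  "('a::real_inner \<Rightarrow> real) \<Rightarrow> ('a \<Rightarrow> 'b::real_inner) \<Rightarrow> 'b set \<Rightarrow> 'a \<Rightarrow> 'a \<Rightarrow> 'b \<Rightarrow> 'b set" where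
  "multipliers f G K x a b = {y. (x, y) \<in> S_KKT f G K a b}"

definition X_KKT ::
  "('a::real_inner \<Rightarrow> real) \<Rightarrow> ('a \<Rightarrow> 'b::real_inner) \<Rightarrow> 'b set \<Rightarrow> 'a \<Rightarrow> 'b \<Rightarrow> 'a set" where
  "X_KKT f G K a b = {x. \<exists>y. (x, y) \<in> S_KKT f G K a b}"

definition RCQ :: "('a::real_normed_vector \<Rightarrow> 'b::real_normed_vector) \<Rightarrow> 'b set \<Rightarrow> 'a \<Rightarrow> bool" where
  "RCQ G K x \<longleftrightarrow>
    {u + v | u v. u \<in> range (frechet_derivative G (at x)) \<and> v \<in> tangent_cone K (G x)} = UNIV"

definition critical_cone ::
  "('a::real_normed_vector \<Rightarrow> real) \<Rightarrow> ('a \<Rightarrow> 'b::real_normed_vector) \<Rightarrow> 'b set \<Rightarrow> 'a \<Rightarrow> 'a set" where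
  "critical_cone f G K x =
    {d. frechet_derivative G (at x) d \<in> tangent_cone K (G x) \<and> frechet_derivative f (at x) d \<le> 0}"

definition robinson_SOSC ::
  "('a::real_inner \<Rightarrow> real) \<Rightarrow> ('a \<Rightarrow> 'b::real_inner) \<Rightarrow> 'b set \<Rightarrow> 'a \<Rightarrow> bool" where
  "robinson_SOSC f G K x \<longleftrightarrow>
    (\<forall>d \<in> critical_cone f G K x - {0}.
      (INF y \<in> multipliers f G K x 0 0.
         ereal (d \<bullet> hessian (\<lambda>u. lagrangian f G u y) x d)
         - support_function y (second_order_tangent_set K (G x) (frechet_derivative G (at x) d)))
      > 0)"

definition set_lsc_at ::
  "('p::topological_space \<Rightarrow> 'q::topological_space set) \<Rightarrow> 'p \<Rightarrow> 'q \<Rightarrow> bool" where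
  "set_lsc_at \<Psi> p q \<longleftrightarrow>
    q \<in> \<Psi> p \<and>
    (\<forall>O'. open O' \<and> q \<in> O' \<longrightarrow> (\<exists>U. open U \<and> p \<in> U \<and> (\<forall>p'\<in>U. \<Psi> p' \<inter> O' \<noteq> {})))"

definition set_usc_at ::
  "('p::topological_space \<Rightarrow> 'q::topological_space set) \<Rightarrow> 'p \<Rightarrow> bool" where
  "set_usc_at \<Psi> p \<longleftrightarrow>
    (\<forall>O'. open O' \<and> \<Psi> p \<subseteq> O' \<longrightarrow> (\<exists>U. open U \<and> p \<in> U \<and> (\<forall>p'\<in>U. \<Psi> p' \<subseteq> O')))"

definition set_continuous_at ::
  "('p::topological_space \<Rightarrow> 'q::topological_space set) \<Rightarrow> 'p \<Rightarrow> 'q \<Rightarrow> bool" where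
  "set_continuous_at \<Psi> p q \<longleftrightarrow> set_lsc_at \<Psi> p q \<and> set_usc_at \<Psi> p"

end

theory Submission
  imports Defs
begin

text \<open>
  The proof has two independent halves: the isolation of \<open>xbar\<close> as a stationary point, which uses the
  second-order condition, and a stability argument that uses only isolation, local optimality and
  Robinson's condition.

  Robinson's condition is used in dual form: no nonzero normal vector of \<open>K\<close> at \<open>G xbar\<close> is annihilated
  by the adjoint of \<open>G' xbar\<close>. In finite dimensions, compactness makes this quantitative and uniform
  nearby (\<open>uniform_dual_bound\<close>). It follows that multipliers stay bounded, that feasibility can be restored
  at a cost proportional to the residual (\<open>metric_regularity\<close>), and that local minimisers have multipliers
  (\<open>multiplier_exists\<close>).

  For isolation (\<open>stationary_point_isolated\<close>), suppose stationary points \<open>X n \<noteq> xbar\<close> with multipliers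
  \<open>Y n\<close> tend to \<open>xbar\<close>. Expanding the Lagrangian with multiplier \<open>Y n\<close> at \<open>X n\<close>, where its gradient
  vanishes, compares \<open>f xbar\<close> with \<open>f (X n)\<close> up to the term \<open>Y n \<bullet> (G xbar - G (X n))\<close>. Cone
  reducibility shows that, to second order and along a subsequence, this term is given by an element of the
  second-order tangent set (\<open>cone_reducible_curvature\<close>). The second-order condition then gives
  \<open>f (X n) < f xbar\<close>, against local optimality. The reducing map is itself a regular constraint once its
  cone is enlarged by a complement of its range, so the same multiplier rule and metric regularity
  apply to it.

  For stability (\<open>stationary_points_continuous\<close>), isolation makes \<open>xbar\<close> the unique minimiser on a small
  ball, because other minimisers would be stationary too. Minimisers of the perturbed problems over a smaller
  ball converge to it, and any stationary points of the perturbed problems in the ball do so by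
  boundedness of multipliers.
\<close>

section \<open>Normal cones and projections\<close>

lemma normal_cone_base: "y \<in> normal_cone K z \<Longrightarrow> z \<in> K"
  by (auto simp: normal_cone_def split: if_splits)

lemma normal_coneD: "y \<in> normal_cone K z \<Longrightarrow> w \<in> K \<Longrightarrow> y \<bullet> (w - z) \<le> 0"
  by (auto simp: normal_cone_def split: if_splits)

lemma normal_coneI: "z \<in> K \<Longrightarrow> (\<And>w. w \<in> K \<Longrightarrow> y \<bullet> (w - z) \<le> 0) \<Longrightarrow> y \<in> normal_cone K z"
  by (auto simp: normal_cone_def)

lemma normal_cone_scaleR: "0 \<le> c \<Longrightarrow> y \<in> normal_cone K z \<Longrightarrow> c *\<^sub>R y \<in> normal_cone K z"
  by (auto simp: normal_cone_def mult_nonneg_nonpos split: if_splits)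

lemma normal_cone_limit:
  assumes "closed K" and "\<forall>\<^sub>F n in sequentially. y n \<in> normal_cone K (z n)"
    and y: "y \<longlonglongrightarrow> y0" and z: "z \<longlonglongrightarrow> z0"
  shows "y0 \<in> normal_cone K z0"
proof (rule normal_coneI)
  show "z0 \<in> K"
    using assms(2) by (intro Lim_in_closed_set[OF \<open>closed K\<close> _ _ z])
      (auto elim!: eventually_mono dest: normal_cone_base)
  fix w assume "w \<in> K"
  have "(\<lambda>n. y n \<bullet> (w - z n)) \<longlonglongrightarrow> y0 \<bullet> (w - z0)"
    by (intro tendsto_intros y z)
  then show "y0 \<bullet> (w - z0) \<le> 0"
    using assms(2) \<open>w \<in> K\<close>
    by (auto intro!: tendsto_upperbound elim!: eventually_mono dest: normal_coneD)
qed

lemma normal_cone_closest_point: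
  assumes "closed K" "convex K" "K \<noteq> {}"
  shows "a - closest_point K a \<in> normal_cone K (closest_point K a)"
  using assms by (intro normal_coneI closest_point_in_set closest_point_dot)

lemma infdist_closest_point:
  fixes K :: "'b::euclidean_space set"
  assumes "closed K" "K \<noteq> {}"
  shows "infdist a K = norm (a - closest_point K a)"
  using setdist_closest_point[OF assms] by (simp add: infdist_eq_setdist dist_norm)

lemma normal_cone_polar_tangent_cone:
  assumes y: "y \<in> normal_cone K z" and d: "d \<in> tangent_cone K z"
  shows "y \<bullet> d \<le> 0"
proof -
  obtain zs and t :: "nat \<Rightarrow> real" where zs: "\<And>k. zs k \<in> K" "\<And>k. t k > 0"
    and lim: "(\<lambda>k. (zs k - z) /\<^sub>R t k) \<longlonglongrightarrow> d"
    using d by (auto simp: tangent_cone_def)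
  have "(\<lambda>k. y \<bullet> ((zs k - z) /\<^sub>R t k)) \<longlonglongrightarrow> y \<bullet> d"
    by (intro tendsto_intros lim)
  moreover have "y \<bullet> ((zs k - z) /\<^sub>R t k) \<le> 0" for k
    using normal_coneD[OF y zs(1)[of k]] zs(2)[of k] by (simp add: mult_nonneg_nonpos)
  ultimately show ?thesis by (auto intro: tendsto_upperbound)
qed

text \<open>
  First-order condition at a minimiser of a smooth function plus \<open>\<epsilon>\<close> times the distance to it:
  moving along \<open>h\<close> and along \<open>- h\<close> cannot lower the smooth part faster than the distance grows.
\<close>

lemma derivative_bound_at_min_plus_norm:
  fixes \<theta> :: "'a::real_normed_vector \<Rightarrow> real"
  assumes \<theta>: "(\<theta> has_derivative \<theta>') (at x)" and S: "open S" "x \<in> S"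
    and min: "\<And>u. u \<in> S \<Longrightarrow> \<theta> x \<le> \<theta> u + \<epsilon> * norm (u - x)"
  shows "\<bar>\<theta>' h\<bar> \<le> \<epsilon> * norm h"
proof -
  have lower: "- (\<epsilon> * norm h) \<le> \<theta>' h" for h
  proof -
    have "((\<lambda>s. \<theta> (x + s *\<^sub>R h)) has_derivative (\<lambda>s. \<theta>' (s *\<^sub>R h))) (at 0)"
      by (rule has_derivative_compose[of "\<lambda>s. x + s *\<^sub>R h"])
        (use \<theta> in \<open>auto intro!: derivative_eq_intros\<close>)
    moreover have "(\<lambda>s. \<theta>' (s *\<^sub>R h)) = (*) (\<theta>' h)"
      using has_derivative_linear[OF \<theta>] by (simp add: fun_eq_iff linear_cmul mult.commute)
    ultimately have "((\<lambda>s. \<theta> (x + s *\<^sub>R h)) has_real_derivative \<theta>' h) (at 0)"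
      by (simp add: has_field_derivative_def)
    then have "((\<lambda>s. (\<theta> (x + s *\<^sub>R h) - \<theta> x) / s) \<longlongrightarrow> \<theta>' h) (at 0)"
      by (simp add: has_field_derivative_iff)
    then have lim: "((\<lambda>s. (\<theta> (x + s *\<^sub>R h) - \<theta> x) / s) \<longlongrightarrow> \<theta>' h) (at_right 0)"
      by (rule filterlim_mono) (auto simp: at_le)
    have "((\<lambda>s. x + s *\<^sub>R h) \<longlongrightarrow> x + 0 *\<^sub>R h) (at_right 0)"
      by (intro tendsto_intros)
    then have "\<forall>\<^sub>F s in at_right (0::real). x + s *\<^sub>R h \<in> S"
      using S by (intro topological_tendstoD) auto
    moreover have "\<forall>\<^sub>F s in at_right (0::real). s > 0"
      by (simp add: eventually_at_right_less)
    ultimately have "\<forall>\<^sub>F s in at_right 0. - (\<epsilon> * norm h) \<le> (\<theta> (x + s *\<^sub>R h) - \<theta> x) / s"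
    proof eventually_elim
      case (elim s)
      show ?case using min[OF elim(1)] elim(2) by (simp add: field_simps)
    qed
    with lim show ?thesis by (intro tendsto_lowerbound) auto
  qed
  have "\<theta>' (- h) = - \<theta>' h"
    using has_derivative_linear[OF \<theta>] by (simp add: linear_neg)
  with lower[of h] lower[of "- h"] show ?thesis by auto
qed

lemma eventually_bounded_convergent_subsequence:
  fixes u :: "nat \<Rightarrow> 'a::{heine_borel,real_normed_vector}"
  assumes "\<forall>\<^sub>F n in sequentially. norm (u n) \<le> B"
  obtains r l where "strict_mono r" "(\<lambda>n. u (r n)) \<longlonglongrightarrow> l"
proof -
  obtain N where "\<And>n. n \<ge> N \<Longrightarrow> norm (u n) \<le> B"
    using assms by (auto simp: eventually_sequentially)
  then have "bounded (range (\<lambda>n. u (n + N)))"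
    by (intro boundedI[of _ B]) auto
  then obtain r l where r: "strict_mono r" and l: "((\<lambda>n. u (n + N)) \<circ> r) \<longlonglongrightarrow> l"
    using bounded_imp_convergent_subsequence by blast
  have "strict_mono (\<lambda>n. r n + N)"
    using r by (simp add: strict_mono_def)
  then show ?thesis using l by (intro that[of "\<lambda>n. r n + N"]) (simp_all add: o_def)
qed

section \<open>Constraint systems satisfying Robinson's condition\<close>

text \<open>
  The constraint system \<open>g x \<in> K\<close> under Robinson's condition at \<open>x0\<close>, in its dual form: only the
  zero functional in the normal cone at \<open>g x0\<close> is annihilated by the adjoint of the derivative.
  The domain is an open set \<open>W\<close> because the locale serves both for the constraint of the problem,
  which is smooth everywhere, and for the map that reduces the set to a cone, which is smooth only
  locally.
\<close>

locale regular_constraint =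
  fixes g :: "'a::euclidean_space \<Rightarrow> 'b::euclidean_space"
    and g' :: "'a \<Rightarrow> 'a \<Rightarrow>\<^sub>L 'b" and W :: "'a set" and K :: "'b set" and x0 :: 'a
  assumes open_W: "open W" and x0_in_W: "x0 \<in> W"
    and deriv: "\<And>x. x \<in> W \<Longrightarrow> (g has_derivative g' x) (at x)"
    and cont_deriv: "continuous_on W g'"
    and closed_K: "closed K" and convex_K: "convex K" and feasible_x0: "g x0 \<in> K"
    and dual_regular: "\<And>y. y \<in> normal_cone K (g x0) \<Longrightarrow> (\<And>h. y \<bullet> g' x0 h = 0) \<Longrightarrow> y = 0"
begin

lemma K_nonempty: "K \<noteq> {}" using feasible_x0 by auto

lemma isCont_g: "x \<in> W \<Longrightarrow> isCont g x"
  by (rule has_derivative_continuous[OF deriv])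

lemma cont_g: "continuous_on W g"
  using isCont_g by (auto intro!: continuous_at_imp_continuous_on)

lemma isCont_g': "x \<in> W \<Longrightarrow> isCont g' x"
  using cont_deriv open_W continuous_on_eq_continuous_at by blast

text \<open>
  Compactness of the unit sphere turns the dual condition at one point into an estimate, uniform
  near that point, of a normal vector by its image under the adjoint derivative. Both the
  boundedness of multipliers and metric regularity rest on it. The number \<open>e\<close> stands for any
  bound on the norm of the functional \<open>h \<mapsto> y \<bullet> g' x h\<close>.
\<close>

lemma uniform_dual_bound:
  obtains c \<delta> where "c > 0" "\<delta> > 0"
    "\<And>x p y e. dist x x0 < \<delta> \<Longrightarrow> dist p (g x0) < \<delta> \<Longrightarrow> y \<in> normal_cone K p \<Longrightarrow>
      (\<And>h. \<bar>y \<bullet> g' x h\<bar> \<le> e * norm h) \<Longrightarrow> c * norm y \<le> e"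
proof -
  define good where "good c \<delta> \<longleftrightarrow> (\<forall>x p y e. dist x x0 < \<delta> \<longrightarrow> dist p (g x0) < \<delta> \<longrightarrow>
      y \<in> normal_cone K p \<longrightarrow> (\<forall>h. \<bar>y \<bullet> g' x h\<bar> \<le> e * norm h) \<longrightarrow> c * norm y \<le> e)" for c \<delta>
  have "\<exists>n. good (inverse (real (Suc n))) (inverse (real (Suc n)))"
  proof (rule ccontr)
    assume "\<not> ?thesis"
    \<comment> \<open>If the estimate fails for every constant, normalised violators converge to a unit
      normal vector at \<open>g x0\<close> that the dual condition excludes.\<close>
    then have "\<forall>n. \<exists>x p y e. dist x x0 < inverse (real (Suc n)) \<and> dist p (g x0) < inverse (real (Suc n)) \<and>
      y \<in> normal_cone K p \<and> (\<forall>h. \<bar>y \<bullet> g' x h\<bar> \<le> e * norm h) \<and> e < inverse (real (Suc n)) * norm y"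
      unfolding good_def by (metis not_le)
    then obtain X P Y E where X: "\<And>n. dist (X n) x0 < inverse (real (Suc n))"
      and P: "\<And>n. dist (P n) (g x0) < inverse (real (Suc n))"
      and Y: "\<And>n. Y n \<in> normal_cone K (P n)"
      and E: "\<And>n h. \<bar>Y n \<bullet> g' (X n) h\<bar> \<le> E n * norm h" "\<And>n. E n < inverse (real (Suc n)) * norm (Y n)"
      by metis
    have inv0: "(\<lambda>n. inverse (real (Suc n))) \<longlonglongrightarrow> 0"
      by (rule LIMSEQ_inverse_real_of_nat)
    have X0: "X \<longlonglongrightarrow> x0"
      by (rule metric_tendsto_imp_tendsto[OF inv0]) (use X in \<open>auto simp: less_imp_le\<close>)
    have P0: "P \<longlonglongrightarrow> g x0"
      by (rule metric_tendsto_imp_tendsto[OF inv0]) (use P in \<open>auto simp: less_imp_le\<close>)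
    define u where "u n = (1 / norm (Y n)) *\<^sub>R Y n" for n
    have ubound: "\<bar>u n \<bullet> g' (X n) h\<bar> \<le> inverse (real (Suc n)) * norm h" for n h
    proof (cases "Y n = 0")
      case False
      have "\<bar>Y n \<bullet> g' (X n) h\<bar> \<le> (inverse (real (Suc n)) * norm (Y n)) * norm h"
        using E(1)[of n h] mult_right_mono[OF less_imp_le[OF E(2)[of n]], of "norm h"] by simp
      then have "\<bar>Y n \<bullet> g' (X n) h\<bar> / norm (Y n) \<le> inverse (real (Suc n)) * norm h"
        using False by (simp add: field_simps)
      then show ?thesis by (simp add: u_def abs_mult)
    qed (simp add: u_def)
    have Yn0: "Y n \<noteq> 0" for n
    proof
      assume "Y n = 0"
      then have "E n < 0" "0 \<le> E n * norm (SOME h::'a. h \<in> Basis)"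
        using E(2)[of n] E(1)[of n "SOME h::'a. h \<in> Basis"] by auto
      moreover have "norm (SOME h::'a. h \<in> Basis) = 1"
        by (simp add: SOME_Basis)
      ultimately show False by simp
    qed
    then have nu: "norm (u n) = 1" for n by (simp add: u_def)
    then have "\<forall>\<^sub>F n in sequentially. norm (u n) \<le> 1" by simp
    then obtain r l where r: "strict_mono r" and l: "(\<lambda>n. u (r n)) \<longlonglongrightarrow> l"
      by (rule eventually_bounded_convergent_subsequence)
    have Xr: "(\<lambda>n. X (r n)) \<longlonglongrightarrow> x0" and Pr: "(\<lambda>n. P (r n)) \<longlonglongrightarrow> g x0"
      and ir: "(\<lambda>n. inverse (real (Suc (r n)))) \<longlonglongrightarrow> 0"
      using LIMSEQ_subseq_LIMSEQ[OF X0 r] LIMSEQ_subseq_LIMSEQ[OF P0 r]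
        LIMSEQ_subseq_LIMSEQ[OF inv0 r] by (simp_all add: o_def)
    have "l \<in> normal_cone K (g x0)"
      by (rule normal_cone_limit[OF closed_K _ l Pr])
        (intro always_eventually allI, simp add: u_def normal_cone_scaleR Y)
    moreover have "l \<bullet> g' x0 h = 0" for h
    proof -
      have "(\<lambda>n. u (r n) \<bullet> g' (X (r n)) h) \<longlonglongrightarrow> l \<bullet> g' x0 h"
        by (intro tendsto_intros l isCont_tendsto_compose[OF isCont_g'[OF x0_in_W] Xr])
      moreover have "(\<lambda>n. inverse (real (Suc (r n))) * norm h) \<longlonglongrightarrow> 0"
        by (rule tendsto_mult_left_zero[OF ir])
      then have "(\<lambda>n. u (r n) \<bullet> g' (X (r n)) h) \<longlonglongrightarrow> 0"
        by (rule Lim_null_comparison[rotated]) (intro always_eventually allI, use ubound in simp)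
      ultimately show ?thesis by (rule LIMSEQ_unique)
    qed
    ultimately have "l = 0" by (rule dual_regular)
    moreover have "norm l = 1"
      using tendsto_norm[OF l] nu by (simp add: LIMSEQ_const_iff)
    ultimately show False by simp
  qed
  then obtain n where "good (inverse (real (Suc n))) (inverse (real (Suc n)))" ..
  then show ?thesis
    by (intro that[of "inverse (real (Suc n))" "inverse (real (Suc n))"]) (auto simp: good_def)
qed

lemma small_ball:
  assumes "e > 0"
  obtains r where "r > 0" "cball x0 r \<subseteq> W" "\<And>x. x \<in> cball x0 r \<Longrightarrow> dist (g x) (g x0) < e"
proof -
  obtain r1 where r1: "r1 > 0" "cball x0 r1 \<subseteq> W"
    using open_W x0_in_W open_contains_cball by blast
  obtain r2 where r2: "r2 > 0" "\<And>x. dist x x0 < r2 \<Longrightarrow> dist (g x) (g x0) < e"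
    using isCont_g[OF x0_in_W] \<open>e > 0\<close> unfolding continuous_at_eps_delta by blast
  show ?thesis
    by (rule that[of "min r1 (r2 / 2)"]) (use r1 r2 in \<open>auto simp: dist_commute\<close>)
qed

text \<open>
  Feasibility can be restored at a cost proportional to the residual. Minimise the residual plus
  \<open>\<epsilon>\<close> times the distance to the given point. At a minimiser with positive residual, the unit vector
  from the projection to the image would be normal to \<open>K\<close>, and the first-order condition would bound
  its image under the adjoint derivative by \<open>\<epsilon>\<close>, below the constant of the uniform estimate. Hence
  the minimiser is feasible, and its distance is at most the residual divided by \<open>\<epsilon>\<close>.
\<close>

theorem metric_regularity:
  obtains \<kappa> \<delta> where "\<kappa> > 0" "\<delta> > 0"
    "\<And>x b. dist x x0 < \<delta> \<Longrightarrow> norm b < \<delta> \<Longrightarrow>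
      \<exists>u\<in>W. g u + b \<in> K \<and> dist u x \<le> \<kappa> * infdist (g x + b) K"
proof -
  obtain c \<delta>0 where c: "c > 0" "\<delta>0 > 0" and dual:
    "\<And>x p y e. dist x x0 < \<delta>0 \<Longrightarrow> dist p (g x0) < \<delta>0 \<Longrightarrow> y \<in> normal_cone K p \<Longrightarrow>
      (\<And>h. \<bar>y \<bullet> g' x h\<bar> \<le> e * norm h) \<Longrightarrow> c * norm y \<le> e"
    using uniform_dual_bound by metis
  obtain r0 where r0: "r0 > 0" "cball x0 r0 \<subseteq> W"
      "\<And>x. x \<in> cball x0 r0 \<Longrightarrow> dist (g x) (g x0) < \<delta>0 / 4"
    using small_ball[of "\<delta>0 / 4"] c by auto
  define r where "r = min r0 (\<delta>0 / 2)"
  have r: "r > 0" "cball x0 r \<subseteq> W" "r < \<delta>0"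
      "\<And>x. x \<in> cball x0 r \<Longrightarrow> dist (g x) (g x0) < \<delta>0 / 4"
    using r0 c by (auto simp: r_def)
  define \<epsilon> where "\<epsilon> = c / 2"
  have \<epsilon>: "0 < \<epsilon>" "\<epsilon> < c" using c by (auto simp: \<epsilon>_def)
  obtain r1 where r1: "r1 > 0" "\<And>x. x \<in> cball x0 r1 \<Longrightarrow> dist (g x) (g x0) < \<epsilon> * r / 4"
    using small_ball[of "\<epsilon> * r / 4"] mult_pos_pos[OF \<epsilon>(1) r(1)] by (metis divide_pos_pos zero_less_numeral)
  define \<delta> where "\<delta> = min (min r1 (r / 2)) (min (\<epsilon> * r / 4) (\<delta>0 / 4))"
  have \<delta>: "\<delta> > 0" "\<delta> \<le> r1" "\<delta> \<le> r / 2" "\<delta> \<le> \<epsilon> * r / 4" "\<delta> \<le> \<delta>0 / 4"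
    using r1 r \<epsilon> c by (auto simp: \<delta>_def)
  have "\<exists>u\<in>W. g u + b \<in> K \<and> dist u x \<le> (1 / \<epsilon>) * infdist (g x + b) K"
    if x: "dist x x0 < \<delta>" and b: "norm b < \<delta>" for x b
  proof -
    define \<phi> where "\<phi> u = infdist (g u + b) K + \<epsilon> * dist u x" for u
    have "continuous_on (cball x0 r) g"
      using cont_g r(2) continuous_on_subset by blast
    then have "continuous_on (cball x0 r) \<phi>"
      unfolding \<phi>_def by (intro continuous_intros)
    then obtain u where u: "u \<in> cball x0 r" and umin: "\<And>v. v \<in> cball x0 r \<Longrightarrow> \<phi> u \<le> \<phi> v"
      using continuous_attains_inf[of "cball x0 r" \<phi>] r by (auto simp: less_imp_le)
    have "x \<in> cball x0 r" using x \<delta> r by (auto simp: dist_commute)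
    then have le: "\<phi> u \<le> infdist (g x + b) K" using umin[of x] by (simp add: \<phi>_def)
    have "infdist (g x + b) K \<le> dist (g x + b) (g x0)"
      by (rule infdist_le[OF feasible_x0])
    also have "\<dots> \<le> dist (g x) (g x0) + norm b"
      by (smt (verit) add_diff_eq diff_add_eq dist_norm norm_triangle_ineq)
    also have "\<dots> < \<epsilon> * r / 4 + \<epsilon> * r / 4"
      using r1(2)[of x] x \<delta> b by (intro add_strict_mono) (auto simp: dist_commute)
    \<comment> \<open>The bound \<open>\<delta>\<close> makes the initial residual less than \<open>\<epsilon> * r / 2\<close>, so that the minimiser
      stays off the boundary of the ball.\<close>
    finally have "infdist (g x + b) K < \<epsilon> * (r / 2)" by simp
    moreover have *: "\<epsilon> * dist u x \<le> infdist (g x + b) K"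
      using le infdist_nonneg[of "g u + b" K] by (simp add: \<phi>_def)
    ultimately have "\<epsilon> * dist u x < \<epsilon> * (r / 2)" by linarith
    then have "dist u x < r / 2" using \<epsilon>(1) by (simp only: mult_less_cancel_left_pos)
    then have u_int: "u \<in> ball x0 r"
      using x \<delta> dist_triangle[of x0 u x] by (simp add: dist_commute)
    have "infdist (g u + b) K = 0"
    proof (rule ccontr)
      assume pos: "infdist (g u + b) K \<noteq> 0"
      define p where "p = closest_point K (g u + b)"
      define v where "v = g u + b - p"
      have nv: "norm v = infdist (g u + b) K"
        using infdist_closest_point[OF closed_K K_nonempty] by (simp add: v_def p_def)
      then have v0: "v \<noteq> 0" using pos by auto
      have pK: "p \<in> K" unfolding p_def by (rule closest_point_in_set[OF closed_K K_nonempty])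
      have vN: "v \<in> normal_cone K p"
        unfolding v_def p_def by (rule normal_cone_closest_point[OF closed_K convex_K K_nonempty])
      have uW: "u \<in> W" using u r by auto
      have "norm v \<le> dist (g u + b) (g x0)"
        unfolding nv by (rule infdist_le[OF feasible_x0])
      moreover have "dist p (g x0) \<le> norm v + dist (g u + b) (g x0)"
        using dist_triangle3[of p "g x0" "g u + b"] by (simp add: v_def dist_norm)
      moreover have "dist (g u + b) (g x0) \<le> dist (g u) (g x0) + norm b"
        by (smt (verit) add_diff_eq diff_add_eq dist_norm norm_triangle_ineq)
      moreover have "dist (g u) (g x0) < \<delta>0 / 4" "norm b < \<delta>0 / 4"
        using r(4)[OF u] b \<delta> by auto
      ultimately have p_near: "dist p (g x0) < \<delta>0" by linarith
      \<comment> \<open>The distance to the fixed point \<open>p\<close> majorises the residual and agrees with it at \<open>u\<close>, but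
        is differentiable there.\<close>
      define \<theta> where "\<theta> w = norm (g w + b - p)" for w
      have "((\<lambda>w. g w + b - p) has_derivative g' u) (at u)"
        by (auto intro!: derivative_eq_intros deriv uW)
      from has_derivative_compose[OF this has_derivative_norm] v0
      have \<theta>': "(\<theta> has_derivative (\<lambda>h. sgn v \<bullet> g' u h)) (at u)"
        unfolding \<theta>_def v_def by (simp add: inner_commute)
      have "\<theta> u \<le> \<theta> w + \<epsilon> * norm (w - u)" if "w \<in> ball x0 r" for w
      proof -
        have "\<theta> u + \<epsilon> * dist u x = \<phi> u" by (simp add: \<theta>_def \<phi>_def nv[symmetric] v_def)
        also have "\<dots> \<le> \<phi> w" using that by (intro umin) auto
        also have "\<dots> \<le> \<theta> w + \<epsilon> * dist w x"
          using infdist_le[OF pK, of "g w + b"] by (simp add: \<phi>_def \<theta>_def dist_norm)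
        also have "\<dots> \<le> \<theta> w + \<epsilon> * (dist w u + dist u x)"
          using dist_triangle[of w x u] \<epsilon> by (intro add_left_mono mult_left_mono) auto
        finally show ?thesis by (simp add: algebra_simps dist_norm)
      qed
      from derivative_bound_at_min_plus_norm[OF \<theta>' open_ball u_int this]
      have "\<bar>sgn v \<bullet> g' u h\<bar> \<le> \<epsilon> * norm h" for h by simp
      moreover have "sgn v \<in> normal_cone K p"
        unfolding sgn_div_norm by (intro normal_cone_scaleR vN) simp
      ultimately have "c * norm (sgn v) \<le> \<epsilon>"
        using u_int r(3) by (intro dual[OF _ p_near]) (auto simp: dist_commute)
      then show False using v0 \<epsilon> by (simp add: norm_sgn)
    qed
    then have "g u + b \<in> K"
      using in_closed_iff_infdist_zero[OF closed_K K_nonempty] by simp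
    then show ?thesis using * u r \<epsilon> by (intro bexI[of _ u]) (auto simp: field_simps)
  qed
  then show ?thesis using \<epsilon> \<delta> by (intro that[of "1 / \<epsilon>" \<delta>]) auto
qed

text \<open>
  The uniform estimate makes the dual condition stable under perturbation of the point and of the
  right-hand side.
\<close>

lemma regular_nearby:
  obtains \<delta> where "\<delta> > 0" "cball x0 \<delta> \<subseteq> W"
    "\<And>x b. dist x x0 \<le> \<delta> \<Longrightarrow> norm b \<le> \<delta> \<Longrightarrow> g x + b \<in> K \<Longrightarrow>
      regular_constraint (\<lambda>u. g u + b) g' W K x"
proof -
  obtain c \<delta>0 where c: "c > 0" "\<delta>0 > 0" and dual:
    "\<And>x p y e. dist x x0 < \<delta>0 \<Longrightarrow> dist p (g x0) < \<delta>0 \<Longrightarrow> y \<in> normal_cone K p \<Longrightarrow>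
      (\<And>h. \<bar>y \<bullet> g' x h\<bar> \<le> e * norm h) \<Longrightarrow> c * norm y \<le> e"
    using uniform_dual_bound by metis
  obtain r where r: "r > 0" "cball x0 r \<subseteq> W"
      "\<And>x. x \<in> cball x0 r \<Longrightarrow> dist (g x) (g x0) < \<delta>0 / 2"
    using small_ball[of "\<delta>0 / 2"] c by auto
  define \<delta> where "\<delta> = min r (\<delta>0 / 3)"
  have \<delta>: "\<delta> > 0" "\<delta> \<le> r" "\<delta> < \<delta>0 / 2" using r c by (auto simp: \<delta>_def)
  have "regular_constraint (\<lambda>u. g u + b) g' W K x"
    if x: "dist x x0 \<le> \<delta>" and b: "norm b \<le> \<delta>" and K: "g x + b \<in> K" for x b
  proof
    show "open W" "continuous_on W g'" "closed K" "convex K" "g x + b \<in> K"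
      using open_W cont_deriv closed_K convex_K K by auto
    show "x \<in> W" using r x \<delta> by (auto simp: dist_commute subset_iff)
    show "((\<lambda>u. g u + b) has_derivative g' u) (at u)" if "u \<in> W" for u
      by (auto intro!: derivative_eq_intros deriv that)
    fix y assume y: "y \<in> normal_cone K (g x + b)" and 0: "\<And>h. y \<bullet> g' x h = 0"
    have "dist (g x + b) (g x0) \<le> dist (g x) (g x0) + norm b"
      by (smt (verit) add_diff_eq diff_add_eq dist_norm norm_triangle_ineq)
    also have "\<dots> < \<delta>0" using r(3)[of x] x b \<delta> by (auto simp: dist_commute)
    finally have "c * norm y \<le> 0"
      using x \<delta> c y 0 by (intro dual[of x "g x + b"]) auto
    then show "y = 0" using c by (simp add: mult_le_0_iff)
  qed
  then show ?thesis using \<delta> r by (intro that[of \<delta>]) auto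
qed

text \<open>
  Existence of multipliers by quadratic penalisation: the scaled residuals \<open>n *\<^sub>R (g (X n) - p n)\<close> at
  penalised minimisers are normal vectors that satisfy the stationarity equation up to a term tending
  to zero. The uniform estimate bounds them, and a limit point is a multiplier.
\<close>

theorem multiplier_exists:
  fixes \<phi> :: "'a \<Rightarrow> real" and \<phi>' :: "'a \<Rightarrow> 'a \<Rightarrow>\<^sub>L real"
  assumes \<phi>: "\<And>x. x \<in> W \<Longrightarrow> (\<phi> has_derivative \<phi>' x) (at x)" "continuous_on W \<phi>'"
    and U: "open U" "x0 \<in> U" and opt: "\<And>u. u \<in> W \<inter> U \<Longrightarrow> g u \<in> K \<Longrightarrow> \<phi> x0 \<le> \<phi> u"
  obtains y where "y \<in> normal_cone K (g x0)" "\<And>h. \<phi>' x0 h + y \<bullet> g' x0 h = 0"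
proof -
  obtain c \<delta> where c: "c > 0" "\<delta> > 0" and dual:
    "\<And>x p y e. dist x x0 < \<delta> \<Longrightarrow> dist p (g x0) < \<delta> \<Longrightarrow> y \<in> normal_cone K p \<Longrightarrow>
      (\<And>h. \<bar>y \<bullet> g' x h\<bar> \<le> e * norm h) \<Longrightarrow> c * norm y \<le> e"
    using uniform_dual_bound by metis
  obtain r where r: "r > 0" "cball x0 r \<subseteq> W \<inter> U"
    using open_W x0_in_W U open_contains_cball[of "W \<inter> U"] by (metis IntI open_Int)
  then have rW: "cball x0 r \<subseteq> W" by auto
  have cont: "continuous_on (cball x0 r) g" "continuous_on (cball x0 r) \<phi>"
    using cont_g rW \<phi>(1) has_derivative_continuous continuous_on_subset
    by (blast intro: continuous_at_imp_continuous_on)+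
  \<comment> \<open>The last term singles out \<open>x0\<close> among the feasible points of the ball that minimise \<open>\<phi>\<close>,
    so that the penalised minimisers converge to it.\<close>
  define F where "F n u = \<phi> u + real n / 2 * (infdist (g u) K)\<^sup>2 + 1 / 2 * (norm (u - x0))\<^sup>2" for n u
  have "\<exists>u\<in>cball x0 r. \<forall>v\<in>cball x0 r. F n u \<le> F n v" for n
    unfolding F_def using r by (intro continuous_attains_inf continuous_intros cont) auto
  then obtain X where X: "\<And>n. X n \<in> cball x0 r" and Xmin: "\<And>n v. v \<in> cball x0 r \<Longrightarrow> F n (X n) \<le> F n v"
    by metis
  have Fx0: "F n x0 = \<phi> x0" for n
    using feasible_x0 by (simp add: F_def)
  have FX: "F n (X n) \<le> \<phi> x0" for n
    using Xmin[of x0 n] r Fx0 by simp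
  obtain m where m: "\<And>u. u \<in> cball x0 r \<Longrightarrow> m \<le> \<phi> u"
    using continuous_attains_inf[OF _ _ cont(2)] r by force
  have "norm (X n) \<le> norm x0 + r" for n
    using X[of n] norm_triangle_sub[of "X n" x0] by (simp add: dist_norm norm_minus_commute)
  then have "\<forall>\<^sub>F n in sequentially. norm (X n) \<le> norm x0 + r" by simp
  then obtain s xs where s: "strict_mono s" and Xs: "(\<lambda>n. X (s n)) \<longlonglongrightarrow> xs"
    by (rule eventually_bounded_convergent_subsequence)
  have xs: "xs \<in> cball x0 r"
    using Lim_in_closed_set[OF closed_cball _ _ Xs] X by auto
  have gXs: "(\<lambda>n. g (X (s n))) \<longlonglongrightarrow> g xs"
    by (rule isCont_tendsto_compose[OF isCont_g Xs]) (use xs rW in auto)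
  have \<phi>Xs: "(\<lambda>n. \<phi> (X (s n))) \<longlonglongrightarrow> \<phi> xs"
    by (rule isCont_tendsto_compose[OF has_derivative_continuous[OF \<phi>(1)] Xs]) (use xs rW in auto)
  have sinf: "filterlim (\<lambda>n. real (s n)) at_top sequentially"
    by (rule filterlim_compose[OF filterlim_real_sequentially filterlim_subseq[OF s]])
  have "(infdist (g (X n)) K)\<^sup>2 \<le> 2 * (\<phi> x0 - m) / n" if "n > 0" for n
  proof -
    have "n / 2 * (infdist (g (X n)) K)\<^sup>2 \<le> \<phi> x0 - m"
      using FX[of n] m[OF X[of n]] zero_le_power2[of "norm (X n - x0)"] unfolding F_def by linarith
    then show ?thesis using that by (simp add: field_simps)
  qed
  moreover have "\<forall>\<^sub>F n in sequentially. s n > 0"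
    using eventually_gt_at_top[of 0] by eventually_elim (metis s seq_suble less_le_trans)
  ultimately have ev: "\<forall>\<^sub>F n in sequentially. (infdist (g (X (s n))) K)\<^sup>2 \<le> 2 * (\<phi> x0 - m) / s n"
    by (auto elim: eventually_mono)
  have "(\<lambda>n. 2 * (\<phi> x0 - m) / s n) \<longlonglongrightarrow> 0"
    by (intro tendsto_divide_0[OF tendsto_const] filterlim_at_top_imp_at_infinity sinf)
  then have "(\<lambda>n. (infdist (g (X (s n))) K)\<^sup>2) \<longlonglongrightarrow> 0"
    by (intro tendsto_sandwich[OF always_eventually ev tendsto_const]) simp_all
  moreover have "(\<lambda>n. (infdist (g (X (s n))) K)\<^sup>2) \<longlonglongrightarrow> (infdist (g xs) K)\<^sup>2"
    by (intro tendsto_intros gXs)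
  ultimately have "infdist (g xs) K = 0"
    using LIMSEQ_unique by fastforce
  then have "g xs \<in> K"
    using in_closed_iff_infdist_zero[OF closed_K K_nonempty] by simp
  then have "\<phi> x0 \<le> \<phi> xs" using opt[of xs] xs r(2) by blast
  moreover have "\<phi> xs + 1 / 2 * (norm (xs - x0))\<^sup>2 \<le> \<phi> x0"
  proof (rule tendsto_upperbound)
    show "(\<lambda>n. \<phi> (X (s n)) + 1 / 2 * (norm (X (s n) - x0))\<^sup>2) \<longlonglongrightarrow> \<phi> xs + 1 / 2 * (norm (xs - x0))\<^sup>2"
      by (intro tendsto_intros \<phi>Xs Xs)
    have "\<phi> (X n) + 1 / 2 * (norm (X n - x0))\<^sup>2 \<le> \<phi> x0" for n
      using FX[of n] by (smt (verit) F_def mult_nonneg_nonneg divide_nonneg_nonneg of_nat_0_le_iff zero_le_power2)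
    then show "\<forall>\<^sub>F n in sequentially. \<phi> (X (s n)) + 1 / 2 * (norm (X (s n) - x0))\<^sup>2 \<le> \<phi> x0"
      by simp
  qed simp
  ultimately have "(norm (xs - x0))\<^sup>2 \<le> 0" by linarith
  then have xs_eq: "xs = x0" by simp
  define p where "p n = closest_point K (g (X n))" for n
  define Y where "Y n = real n *\<^sub>R (g (X n) - p n)" for n
  have pK: "p n \<in> K" for n unfolding p_def by (rule closest_point_in_set[OF closed_K K_nonempty])
  have YN: "Y n \<in> normal_cone K (p n)" for n
    unfolding Y_def p_def
    by (intro normal_cone_scaleR normal_cone_closest_point closed_K convex_K K_nonempty) simp
  have ps: "(\<lambda>n. p (s n)) \<longlonglongrightarrow> g x0"
  proof -
    have "(\<lambda>n. closest_point K (g (X (s n)))) \<longlonglongrightarrow> closest_point K (g x0)"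
      using gXs xs_eq
      by (intro isCont_tendsto_compose[OF continuous_at_closest_point] convex_K closed_K K_nonempty) auto
    then show ?thesis using feasible_x0 by (simp add: p_def closest_point_self)
  qed
  have stat: "\<phi>' (X n) h + Y n \<bullet> g' (X n) h + (X n - x0) \<bullet> h = 0" if "X n \<in> ball x0 r" for n h
  proof -
    \<comment> \<open>Freezing the projection point gives a smooth majorant of the penalised function, equal to it
      at \<open>X n\<close>; so the squared distance need not be differentiated.\<close>
    define H where "H u = \<phi> u + real n / 2 * ((g u - p n) \<bullet> (g u - p n)) + 1 / 2 * ((u - x0) \<bullet> (u - x0))" for u
    have XW: "X n \<in> W" using X rW by blast
    have dg: "((\<lambda>u. g u - p n) has_derivative g' (X n)) (at (X n))"
      using has_derivative_diff[OF deriv[OF XW] has_derivative_const] by simp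
    have dx: "((\<lambda>u. u - x0) has_derivative (\<lambda>h. h)) (at (X n))"
      using has_derivative_diff[OF has_derivative_ident has_derivative_const] by simp
    have "(H has_derivative (\<lambda>h. \<phi>' (X n) h
        + real n / 2 * ((g (X n) - p n) \<bullet> g' (X n) h + g' (X n) h \<bullet> (g (X n) - p n))
        + 1 / 2 * ((X n - x0) \<bullet> h + h \<bullet> (X n - x0)))) (at (X n))"
      unfolding H_def
      by (intro has_derivative_add has_derivative_mult_right has_derivative_inner dg dx \<phi>(1) XW)
    moreover have "(\<lambda>h. \<phi>' (X n) h
        + real n / 2 * ((g (X n) - p n) \<bullet> g' (X n) h + g' (X n) h \<bullet> (g (X n) - p n))
        + 1 / 2 * ((X n - x0) \<bullet> h + h \<bullet> (X n - x0)))
      = (\<lambda>h. \<phi>' (X n) h + Y n \<bullet> g' (X n) h + (X n - x0) \<bullet> h)"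
      by (rule ext) (simp add: Y_def inner_commute)
    ultimately have "(H has_derivative (\<lambda>h. \<phi>' (X n) h + Y n \<bullet> g' (X n) h + (X n - x0) \<bullet> h)) (at (X n))"
      by simp
    moreover have "H (X n) \<le> H u" if "u \<in> ball x0 r" for u
    proof -
      have "H (X n) = F n (X n)"
        using infdist_closest_point[OF closed_K K_nonempty, of "g (X n)"]
        by (simp add: H_def F_def p_def dot_square_norm)
      also have "\<dots> \<le> F n u" using that by (intro Xmin) auto
      also have "\<dots> \<le> H u"
      proof -
        have "infdist (g u) K \<le> norm (g u - p n)"
          using infdist_le[OF pK] by (simp add: dist_norm)
        then have "(infdist (g u) K)\<^sup>2 \<le> (norm (g u - p n))\<^sup>2"
          by (intro power_mono infdist_nonneg)
        then show ?thesis
          by (auto simp: H_def F_def dot_square_norm intro!: mult_left_mono)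
      qed
      finally show ?thesis .
    qed
    ultimately have "(\<lambda>h. \<phi>' (X n) h + Y n \<bullet> g' (X n) h + (X n - x0) \<bullet> h) = (\<lambda>h. 0)"
      using that by (intro differential_zero_maxmin[of "X n" "ball x0 r" H]) auto
    then show ?thesis by metis
  qed
  have ev_r: "\<forall>\<^sub>F n in sequentially. dist (X (s n)) x0 < e" if "e > 0" for e
    using tendstoD[OF Xs that] xs_eq by simp
  have \<phi>'s: "(\<lambda>n. \<phi>' (X (s n))) \<longlonglongrightarrow> \<phi>' x0"
  proof (rule isCont_tendsto_compose[of x0 \<phi>'])
    show "isCont \<phi>' x0"
      using \<phi>(2) x0_in_W continuous_on_eq_continuous_at[OF open_W] by blast
    show "(\<lambda>n. X (s n)) \<longlonglongrightarrow> x0" using Xs xs_eq by simp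
  qed
  have g's: "(\<lambda>n. g' (X (s n))) \<longlonglongrightarrow> g' x0"
    using isCont_tendsto_compose[OF isCont_g'[OF x0_in_W]] Xs xs_eq by blast
  have "\<forall>\<^sub>F n in sequentially. norm (\<phi>' (X (s n))) < norm (\<phi>' x0) + 1"
    by (rule order_tendstoD[OF tendsto_norm[OF \<phi>'s]]) simp
  then have "\<forall>\<^sub>F n in sequentially. norm (Y (s n)) \<le> (norm (\<phi>' x0) + 1 + r) / c"
    using ev_r[OF r(1)] ev_r[OF c(2)] tendstoD[OF ps c(2)]
  proof eventually_elim
    case (elim n)
    have "\<bar>Y (s n) \<bullet> g' (X (s n)) h\<bar> \<le> (norm (\<phi>' x0) + 1 + r) * norm h" for h
    proof -
      have "\<bar>Y (s n) \<bullet> g' (X (s n)) h\<bar> \<le> \<bar>\<phi>' (X (s n)) h\<bar> + \<bar>(X (s n) - x0) \<bullet> h\<bar>"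
        using stat[of "s n" h] elim(2) by (simp add: dist_commute)
      also have "\<bar>\<phi>' (X (s n)) h\<bar> \<le> norm (\<phi>' (X (s n))) * norm h"
        using norm_blinfun[of "\<phi>' (X (s n))" h] by simp
      also have "\<dots> \<le> (norm (\<phi>' x0) + 1) * norm h"
        using elim(1) by (intro mult_right_mono) auto
      also have "\<bar>(X (s n) - x0) \<bullet> h\<bar> \<le> norm (X (s n) - x0) * norm h"
        by (rule Cauchy_Schwarz_ineq2)
      also have "\<dots> \<le> r * norm h"
        using elim(2) by (intro mult_right_mono) (auto simp: dist_norm)
      finally show ?thesis by (simp add: algebra_simps)
    qed
    then have "c * norm (Y (s n)) \<le> norm (\<phi>' x0) + 1 + r"
      using elim by (intro dual[OF _ _ YN]) auto
    then show ?case using c by (simp add: field_simps)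
  qed
  then obtain q y where q: "strict_mono q" and y: "(\<lambda>n. Y (s (q n))) \<longlonglongrightarrow> y"
    by (rule eventually_bounded_convergent_subsequence)
  have Xq: "(\<lambda>n. X (s (q n))) \<longlonglongrightarrow> x0" "(\<lambda>n. p (s (q n))) \<longlonglongrightarrow> g x0"
    "(\<lambda>n. \<phi>' (X (s (q n)))) \<longlonglongrightarrow> \<phi>' x0" "(\<lambda>n. g' (X (s (q n)))) \<longlonglongrightarrow> g' x0"
    using LIMSEQ_subseq_LIMSEQ[OF Xs q] LIMSEQ_subseq_LIMSEQ[OF ps q]
      LIMSEQ_subseq_LIMSEQ[OF \<phi>'s q] LIMSEQ_subseq_LIMSEQ[OF g's q] xs_eq by (simp_all add: o_def)
  show ?thesis
  proof (rule that)
    show "y \<in> normal_cone K (g x0)"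
      by (rule normal_cone_limit[OF closed_K _ y Xq(2)]) (simp add: YN)
    fix h
    have "(\<lambda>n. \<phi>' (X (s (q n))) h + Y (s (q n)) \<bullet> g' (X (s (q n))) h + (X (s (q n)) - x0) \<bullet> h)
        \<longlonglongrightarrow> \<phi>' x0 h + y \<bullet> g' x0 h + (x0 - x0) \<bullet> h"
      by (intro tendsto_intros Xq y)
    moreover have "\<forall>\<^sub>F n in sequentially. X (s (q n)) \<in> ball x0 r"
      using tendstoD[OF Xq(1) r(1)] by (simp add: dist_commute)
    then have "\<forall>\<^sub>F n in sequentially.
        \<phi>' (X (s (q n))) h + Y (s (q n)) \<bullet> g' (X (s (q n))) h + (X (s (q n)) - x0) \<bullet> h = 0"
      by eventually_elim (rule stat)
    then have "(\<lambda>n. \<phi>' (X (s (q n))) h + Y (s (q n)) \<bullet> g' (X (s (q n))) h + (X (s (q n)) - x0) \<bullet> h)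
        \<longlonglongrightarrow> 0"
      by (rule tendsto_eventually)
    ultimately have "\<phi>' x0 h + y \<bullet> g' x0 h + (x0 - x0) \<bullet> h = 0"
      by (rule LIMSEQ_unique)
    then show "\<phi>' x0 h + y \<bullet> g' x0 h = 0" by simp
  qed
qed

end

section \<open>Second-order expansions\<close>

text \<open>
  A Taylor expansion with variable base point but fixed second derivative. The function \<open>\<psi>\<close> on the
  segment keeps both arguments of the second derivative equal to \<open>e\<close>, so
  that only its quadratic form appears.
\<close>

lemma C2_strict_taylor:
  fixes g :: "'a::euclidean_space \<Rightarrow> 'b::euclidean_space"
  assumes W: "open W" "A \<in> W"
    and g': "\<And>x. x \<in> W \<Longrightarrow> (g has_derivative blinfun_apply (g' x)) (at x)"
    and g'': "\<And>x. x \<in> W \<Longrightarrow> (g' has_derivative blinfun_apply (g'' x)) (at x)"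
    and cont: "continuous_on W g''" and "\<epsilon> > 0"
  obtains \<delta> where "\<delta> > 0" "\<And>u v. dist u A < \<delta> \<Longrightarrow> dist v A < \<delta> \<Longrightarrow>
    norm (g u - g v - g' v (u - v) - (1 / 2) *\<^sub>R g'' A (u - v) (u - v)) \<le> \<epsilon> * (norm (u - v))\<^sup>2"
proof -
  obtain r where r: "r > 0" "ball A r \<subseteq> W" using W open_contains_ball by blast
  have "isCont g'' A" using cont W continuous_on_eq_continuous_at by blast
  then obtain s where s: "s > 0" "\<And>x. dist x A < s \<Longrightarrow> dist (g'' x) (g'' A) < \<epsilon>"
    using \<open>\<epsilon> > 0\<close> unfolding continuous_at_eps_delta by blast
  define \<delta> where "\<delta> = min r s"
  have \<delta>: "\<delta> > 0" "\<And>x. x \<in> ball A \<delta> \<Longrightarrow> x \<in> W" "\<And>x. x \<in> ball A \<delta> \<Longrightarrow> norm (g'' x - g'' A) \<le> \<epsilon>"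
    using r s by (auto simp: \<delta>_def dist_norm[symmetric] dist_commute less_imp_le)
  have seg: "v + t *\<^sub>R (u - v) \<in> ball A \<delta>"
    if "u \<in> ball A \<delta>" "v \<in> ball A \<delta>" "t \<in> {0..1}" for u v t
    using convexD_alt[OF convex_ball that(2,1), of t] that(3) by (simp add: algebra_simps)
  have lin: "norm (g' u - g' v - g'' A (u - v)) \<le> norm (u - v) * \<epsilon>"
    if "u \<in> ball A \<delta>" "v \<in> ball A \<delta>" for u v
  proof (rule differentiable_bound_linearization[of v u "ball A \<delta>" g' "\<lambda>x. blinfun_apply (g'' x)" A])
    show "v + t *\<^sub>R (u - v) \<in> ball A \<delta>" if "t \<in> {0..1}" for t
      by (rule seg) fact+
    show "(g' has_derivative blinfun_apply (g'' x)) (at x within ball A \<delta>)" if "x \<in> ball A \<delta>" for x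
      using g'' \<delta> that has_derivative_at_withinI by blast
    show "onorm (blinfun_apply (g'' x) - blinfun_apply (g'' A)) \<le> \<epsilon>" if "x \<in> ball A \<delta>" for x
      using \<delta>(3)[OF that] by (simp add: norm_blinfun.rep_eq minus_blinfun.rep_eq fun_diff_def)
    show "A \<in> ball A \<delta>" using \<delta> by simp
  qed
  have "norm (g u - g v - g' v (u - v) - (1 / 2) *\<^sub>R g'' A (u - v) (u - v)) \<le> \<epsilon> * (norm (u - v))\<^sup>2"
    if u: "u \<in> ball A \<delta>" and v: "v \<in> ball A \<delta>" for u v
  proof -
    define e where "e = u - v"
    define \<psi> where "\<psi> s = g (v + s *\<^sub>R e) - s *\<^sub>R g' v e - (s\<^sup>2 / 2) *\<^sub>R g'' A e e" for s
    define \<psi>' where "\<psi>' s = g' (v + s *\<^sub>R e) e - g' v e - s *\<^sub>R g'' A e e" for s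
    have vd: "(\<psi> has_vector_derivative \<psi>' s) (at s)" if "s \<in> {0..1}" for s
    proof -
      have "v + s *\<^sub>R e \<in> W" using seg[OF u v that] \<delta>(2) by (simp add: e_def)
      then have gd: "(g has_derivative blinfun_apply (g' (v + s *\<^sub>R e))) (at (v + s *\<^sub>R e))"
        by (rule g')
      have "((\<lambda>s. v + s *\<^sub>R e) has_derivative (\<lambda>k. k *\<^sub>R e)) (at s)"
        by (auto intro!: derivative_eq_intros)
      from has_derivative_compose[OF this gd]
      have 1: "((\<lambda>s. g (v + s *\<^sub>R e)) has_vector_derivative g' (v + s *\<^sub>R e) e) (at s)"
        by (simp add: has_vector_derivative_def blinfun.scaleR_right)
      have 2: "((\<lambda>s. s *\<^sub>R g' v e) has_vector_derivative g' v e) (at s)"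
        by (auto intro!: derivative_eq_intros simp: has_vector_derivative_def)
      have "((\<lambda>s. s\<^sup>2 / 2) has_real_derivative s) (at s)"
        by (auto intro!: derivative_eq_intros)
      from has_vector_derivative_scaleR[OF this has_vector_derivative_const]
      have 3: "((\<lambda>s. (s\<^sup>2 / 2) *\<^sub>R g'' A e e) has_vector_derivative s *\<^sub>R g'' A e e) (at s)"
        by simp
      show ?thesis unfolding \<psi>_def \<psi>'_def
        by (intro has_vector_derivative_diff 1 2 3)
    qed
    have "norm (\<psi> 1 - \<psi> 0) \<le> \<epsilon> * (norm e)\<^sup>2 * 1 - \<epsilon> * (norm e)\<^sup>2 * 0"
    proof (rule differentiable_bound_general[of 0 1 \<psi> "\<lambda>s. \<epsilon> * (norm e)\<^sup>2 * s" \<psi>' "\<lambda>_. \<epsilon> * (norm e)\<^sup>2"])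
      show "continuous_on {0..1} \<psi>"
        using vd has_vector_derivative_continuous
        by (intro continuous_at_imp_continuous_on ballI) blast
      show "(\<psi> has_vector_derivative \<psi>' s) (at s)" if "0 < s" "s < 1" for s
        using vd that by simp
      show "norm (\<psi>' s) \<le> \<epsilon> * (norm e)\<^sup>2" if s: "0 < s" "s < 1" for s
      proof -
        have "\<psi>' s = (g' (v + s *\<^sub>R e) - g' v - g'' A (s *\<^sub>R e)) e"
          by (simp add: \<psi>'_def blinfun.diff_left blinfun.scaleR_right blinfun.scaleR_left)
        then have "norm (\<psi>' s) \<le> norm (g' (v + s *\<^sub>R e) - g' v - g'' A (s *\<^sub>R e)) * norm e"
          by (simp add: norm_blinfun)
        also have "\<dots> \<le> (norm (s *\<^sub>R e) * \<epsilon>) * norm e"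
          using lin[OF seg[OF u v, of s] v] s
          by (intro mult_right_mono) (auto simp: e_def)
        also have "\<dots> = s * (\<epsilon> * (norm e)\<^sup>2)" using s by (simp add: power2_eq_square)
        also have "\<dots> \<le> 1 * (\<epsilon> * (norm e)\<^sup>2)"
          using s \<open>\<epsilon> > 0\<close> by (intro mult_right_mono) auto
        finally show ?thesis by simp
      qed
    qed (auto intro!: continuous_intros derivative_eq_intros)
    then show ?thesis by (simp add: \<psi>_def e_def algebra_simps)
  qed
  then show ?thesis using \<delta>(1) by (intro that[of \<delta>]) (auto simp: dist_commute)
qed

text \<open>
  The base point \<open>v n\<close> moves along with \<open>u n\<close>: stationarity holds at perturbed points, and the
  expansions are made around these.
\<close>

lemma C2_taylor_limit:
  fixes g :: "'a::euclidean_space \<Rightarrow> 'b::euclidean_space"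
  assumes W: "open W" "A \<in> W"
    and g': "\<And>x. x \<in> W \<Longrightarrow> (g has_derivative blinfun_apply (g' x)) (at x)"
    and g'': "\<And>x. x \<in> W \<Longrightarrow> (g' has_derivative blinfun_apply (g'' x)) (at x)"
    and cont: "continuous_on W g''"
    and u: "u \<longlonglongrightarrow> A" and v: "v \<longlonglongrightarrow> A" and t: "\<And>n. t n > 0"
    and d: "(\<lambda>n. (u n - v n) /\<^sub>R t n) \<longlonglongrightarrow> d"
  shows "(\<lambda>n. (g (u n) - g (v n) - g' (v n) (u n - v n)) /\<^sub>R (t n)\<^sup>2) \<longlonglongrightarrow> (1 / 2) *\<^sub>R g'' A d d"
proof -
  define D where "D n = (u n - v n) /\<^sub>R t n" for n
  have uv: "u n - v n = t n *\<^sub>R D n" for n using t[of n] by (simp add: D_def)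
  define R where "R n = (g (u n) - g (v n) - g' (v n) (u n - v n)) /\<^sub>R (t n)\<^sup>2 - (1 / 2) *\<^sub>R g'' A (D n) (D n)" for n
  have D: "D \<longlonglongrightarrow> d" using d by (simp add: D_def[abs_def])
  have "R \<longlonglongrightarrow> 0"
  proof (rule metric_LIMSEQ_I)
    fix e :: real assume "e > 0"
    define \<epsilon> where "\<epsilon> = e / ((norm d + 1)\<^sup>2 + 1)"
    have den: "(norm d + 1)\<^sup>2 + 1 > 0" by (rule add_nonneg_pos) auto
    then have \<epsilon>: "\<epsilon> > 0" using \<open>e > 0\<close> by (simp add: \<epsilon>_def)
    obtain \<delta> where \<delta>: "\<delta> > 0" "\<And>u v. dist u A < \<delta> \<Longrightarrow> dist v A < \<delta> \<Longrightarrow>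
      norm (g u - g v - g' v (u - v) - (1 / 2) *\<^sub>R g'' A (u - v) (u - v)) \<le> \<epsilon> * (norm (u - v))\<^sup>2"
      using C2_strict_taylor[OF W g' g'' cont \<epsilon>] by blast
    have "\<forall>\<^sub>F n in sequentially. norm (D n) < norm d + 1"
      by (rule order_tendstoD[OF tendsto_norm[OF D]]) simp
    then have "\<forall>\<^sub>F n in sequentially. dist (R n) 0 < e"
      using tendstoD[OF u \<delta>(1)] tendstoD[OF v \<delta>(1)]
    proof eventually_elim
      case (elim n)
      have "(t n)\<^sup>2 *\<^sub>R R n = g (u n) - g (v n) - g' (v n) (u n - v n) - (1 / 2) *\<^sub>R g'' A (u n - v n) (u n - v n)"
        using t[of n] by (simp add: R_def uv blinfun.scaleR_right blinfun.scaleR_left algebra_simps power2_eq_square)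
      then have "norm ((t n)\<^sup>2 *\<^sub>R R n) \<le> \<epsilon> * (norm (u n - v n))\<^sup>2"
        using \<delta>(2)[OF elim(2,3)] by simp
      then have "(t n)\<^sup>2 * norm (R n) \<le> (t n)\<^sup>2 * (\<epsilon> * (norm (D n))\<^sup>2)"
        by (simp add: uv power_mult_distrib mult_ac)
      then have "norm (R n) \<le> \<epsilon> * (norm (D n))\<^sup>2"
        using t[of n] by simp
      also have "\<dots> \<le> \<epsilon> * (norm d + 1)\<^sup>2"
        using elim(1) \<epsilon> by (intro mult_left_mono power_mono) auto
      also have "\<dots> < \<epsilon> * ((norm d + 1)\<^sup>2 + 1)" using \<epsilon> by simp
      also have "\<dots> = e" using den by (simp add: \<epsilon>_def)
      finally show ?case by simp
    qed
    then show "\<exists>N. \<forall>n\<ge>N. dist (R n) 0 < e" by (simp add: eventually_sequentially)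
  qed
  moreover have "(\<lambda>n. (1 / 2) *\<^sub>R g'' A (D n) (D n)) \<longlonglongrightarrow> (1 / 2) *\<^sub>R g'' A d d"
    by (intro tendsto_intros D)
  ultimately have "(\<lambda>n. R n + (1 / 2) *\<^sub>R g'' A (D n) (D n)) \<longlonglongrightarrow> 0 + (1 / 2) *\<^sub>R g'' A d d"
    by (rule tendsto_add)
  then show ?thesis by (simp add: R_def)
qed

corollary C2_difference_quotient_limit:
  fixes g :: "'a::euclidean_space \<Rightarrow> 'b::euclidean_space"
  assumes W: "open W" "A \<in> W"
    and g': "\<And>x. x \<in> W \<Longrightarrow> (g has_derivative blinfun_apply (g' x)) (at x)"
    and g'': "\<And>x. x \<in> W \<Longrightarrow> (g' has_derivative blinfun_apply (g'' x)) (at x)"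
    and cont: "continuous_on W g''"
    and u: "u \<longlonglongrightarrow> A" and t: "\<And>n. t n > 0" "t \<longlonglongrightarrow> 0"
    and d: "(\<lambda>n. (u n - A) /\<^sub>R t n) \<longlonglongrightarrow> d"
  shows "(\<lambda>n. (g (u n) - g A) /\<^sub>R t n) \<longlonglongrightarrow> g' A d"
proof -
  note T = C2_taylor_limit[OF W g' g'' cont u tendsto_const t(1) d]
  have "(\<lambda>n. g' A ((u n - A) /\<^sub>R t n) + t n *\<^sub>R ((g (u n) - g A - g' A (u n - A)) /\<^sub>R (t n)\<^sup>2))
      \<longlonglongrightarrow> g' A d + 0 *\<^sub>R ((1 / 2) *\<^sub>R g'' A d d)"
    by (intro tendsto_add tendsto_scaleR[OF t(2) T] blinfun.tendsto[OF tendsto_const d])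
  moreover have "g' A ((u n - A) /\<^sub>R t n) + t n *\<^sub>R ((g (u n) - g A - g' A (u n - A)) /\<^sub>R (t n)\<^sup>2)
      = (g (u n) - g A) /\<^sub>R t n" for n
  proof -
    have "t n * inverse ((t n)\<^sup>2) = inverse (t n)"
      using t(1)[of n] by (simp add: power2_eq_square field_simps)
    then show ?thesis by (simp add: blinfun.scaleR_right scaleR_diff_right blinfun.diff_right)
  qed
  ultimately show ?thesis by simp
qed

text \<open>
  A linear projection onto the subspace does not change the function, hence by uniqueness it does not
  change the derivative.
\<close>

lemma derivative_in_subspace:
  fixes F :: "'a::euclidean_space \<Rightarrow> 'b::euclidean_space"
  assumes F': "(F has_derivative F') (at x)" and W: "open W" "x \<in> W"
    and Z: "subspace Z" "\<And>u. u \<in> W \<Longrightarrow> F u \<in> Z"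
  shows "F' h \<in> Z"
proof -
  obtain P where P: "range P \<subseteq> Z" "linear P" "\<And>z. z \<in> Z \<Longrightarrow> P z = z"
    using linear_exists_left_inverse_on[OF linear_id Z(1)] by auto
  have "((\<lambda>u. P (F u)) has_derivative (\<lambda>h. P (F' h))) (at x)"
    using P(2) F' linear_conv_bounded_linear bounded_linear.has_derivative by blast
  then have "(F has_derivative (\<lambda>h. P (F' h))) (at x)"
    by (rule has_derivative_transform_within_open[OF _ W]) (simp add: P Z)
  then have "P (F' h) = F' h"
    using has_derivative_unique[OF F'] by metis
  then show ?thesis using P(1) by (metis range_subsetD)
qed

section \<open>Curvature of cone reducible sets\<close>

text \<open>
  The reducing map takes values in a subspace \<open>Z\<close> that may be proper, so its derivative need not be
  onto the whole space. Replacing the cone \<open>Q\<close> by its preimage \<open>C\<close> under a linear projection onto \<open>Z\<close> leaves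
  the constraint on values in \<open>Z\<close> unchanged and makes the constraint regular: a normal vector to \<open>C\<close>
  at the origin vanishes on the kernel of the projection, so it is zero if it also vanishes on \<open>Z\<close>,
  the range of the derivative. The second derivative also takes values in
  \<open>Z\<close>, which gives the last property.
\<close>

lemma cone_reducible_regular_constraint:
  fixes K :: "'b::euclidean_space set"
  assumes "C2_cone_reducible_at K A"
  obtains W C :: "'b set" and \<Xi> :: "'b \<Rightarrow> 'b" and \<Xi>' \<Xi>'' where "regular_constraint \<Xi> \<Xi>' W C A" "cone C" "\<Xi> A = 0"
    "\<And>x. x \<in> W \<Longrightarrow> (\<Xi>' has_derivative blinfun_apply (\<Xi>'' x)) (at x)" "continuous_on W \<Xi>''"
    "K \<inter> W = {B \<in> W. \<Xi> B \<in> C}" "\<And>h. \<exists>w. \<Xi>' A w = \<Xi>'' A h h"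
proof -
  obtain W Z Q :: "'b set" and \<Xi> :: "'b \<Rightarrow> 'b" where W: "open W" "A \<in> W" and Z: "subspace Z" "Q \<subseteq> Z"
    and Q: "closed Q" "convex Q" "cone Q" "Q \<inter> uminus ` Q = {0}"
    and \<Xi>: "\<Xi> ` W \<subseteq> Z" "C2_on \<Xi> W" "\<Xi> A = 0" "range (frechet_derivative \<Xi> (at A)) = Z"
    and K: "K \<inter> W = {B \<in> W. \<Xi> B \<in> Q}"
    using assms unfolding C2_cone_reducible_at_def by (elim exE conjE) (rule that)
  obtain \<Xi>' \<Xi>'' where d1: "\<And>x. x \<in> W \<Longrightarrow> (\<Xi> has_derivative blinfun_apply (\<Xi>' x)) (at x)"
    and d2: "\<And>x. x \<in> W \<Longrightarrow> (\<Xi>' has_derivative blinfun_apply (\<Xi>'' x)) (at x)"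
    and c2: "continuous_on W \<Xi>''"
    using \<Xi>(2) unfolding C2_on_def by blast
  obtain P where P: "range P \<subseteq> Z" "linear P" "\<And>z. z \<in> Z \<Longrightarrow> P z = z"
    using linear_exists_left_inverse_on[OF linear_id Z(1)] by auto
  define C where "C = P -` Q"
  have Q0: "0 \<in> Q" using Q(4) by auto
  have rg: "range (blinfun_apply (\<Xi>' A)) = Z"
    using frechet_derivative_at[OF d1[OF W(2)]] \<Xi>(4) by simp
  show ?thesis
  proof (rule that[of \<Xi> \<Xi>' W C \<Xi>''])
    show "regular_constraint \<Xi> \<Xi>' W C A"
    proof
      show "open W" "A \<in> W" by fact+
      show "(\<Xi> has_derivative blinfun_apply (\<Xi>' x)) (at x)" if "x \<in> W" for x using d1 that .
      show "continuous_on W \<Xi>'"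
        using d2 has_derivative_continuous by (blast intro: continuous_at_imp_continuous_on)
      show "closed C"
        unfolding C_def using Q(1) P(2) by (simp add: closed_vimage linear_continuous_on linear_conv_bounded_linear)
      show "convex C" unfolding C_def by (rule convex_linear_vimage[OF P(2) Q(2)])
      show "\<Xi> A \<in> C" using Q0 P(2) by (simp add: C_def \<Xi> linear_0)
      fix y assume y: "y \<in> normal_cone C (\<Xi> A)" and 0: "\<And>h. y \<bullet> \<Xi>' A h = 0"
      have "P (y - P y) = 0" using P by (simp add: linear_diff range_subsetD)
      then have "y - P y \<in> C" using Q0 by (simp add: C_def)
      then have "y \<bullet> (y - P y) \<le> 0" using normal_coneD[OF y] \<Xi>(3) by fastforce
      moreover have "P y \<in> range (blinfun_apply (\<Xi>' A))" using P(1) rg by auto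
      then have "y \<bullet> P y = 0" using 0 by auto
      ultimately have "y \<bullet> y \<le> 0" by (simp add: inner_diff_right)
      then show "y = 0" by (meson inner_gt_zero_iff not_le)
    qed
    show "cone C" using Q(3) P(2) by (auto simp: C_def cone_def linear_cmul)
    show "\<Xi> A = 0" by fact
    show "(\<Xi>' has_derivative blinfun_apply (\<Xi>'' x)) (at x)" if "x \<in> W" for x using d2 that .
    show "continuous_on W \<Xi>''" by fact
    show "K \<inter> W = {B \<in> W. \<Xi> B \<in> C}" using K P(3) \<Xi>(1) by (auto simp: C_def)
    show "\<exists>w. \<Xi>' A w = \<Xi>'' A h h" for h
    proof -
      have "\<Xi>' x h \<in> Z" if "x \<in> W" for x
        by (rule derivative_in_subspace[OF d1[OF that] W(1) that Z(1)]) (use \<Xi>(1) in auto)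
      moreover have "((\<lambda>x. \<Xi>' x h) has_derivative (\<lambda>k. \<Xi>'' A k h)) (at A)"
        by (auto intro!: derivative_eq_intros d2 W)
      ultimately have "\<Xi>'' A h h \<in> Z"
        using derivative_in_subspace[OF _ W Z(1), of "\<lambda>x. \<Xi>' x h"] by blast
      then show ?thesis using rg by (metis imageE)
    qed
  qed
qed

lemma normal_cone_of_cone_orthogonal:
  assumes "cone C" "y \<in> normal_cone C z"
  shows "y \<bullet> z = 0"
proof -
  have z: "z \<in> C" by (rule normal_cone_base[OF assms(2)])
  then have "2 *\<^sub>R z \<in> C" "0 *\<^sub>R z \<in> C" using \<open>cone C\<close> unfolding cone_def by (meson order.refl zero_le_numeral)+
  from normal_coneD[OF assms(2) this(1)] normal_coneD[OF assms(2) this(2)]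
  show ?thesis by (simp add: scaleR_2)
qed

text \<open>
  The second-order tangent set sees the curvature of \<open>K\<close> that normal vectors at nearby points see.
  Write \<open>y n\<close> as the adjoint of \<open>\<Xi>' (z n)\<close> applied to a multiplier \<open>m n\<close> normal to the cone. As \<open>m n\<close> is
  orthogonal both to \<open>\<Xi> (z n)\<close> and to \<open>\<Xi> A = 0\<close>, a Taylor expansion of \<open>\<Xi>\<close> at \<open>z n\<close> turns
  \<open>y n \<bullet> (A - z n)\<close> into a quadratic term. Divided by \<open>(t n)\<^sup>2\<close>, it tends to
  \<open>- (\<mu> \<bullet> \<Xi>'' A h h) / 2\<close> along a subsequence on which \<open>m n\<close> converges to \<open>\<mu>\<close>. A vector \<open>w\<close> with
  \<open>\<Xi>' A w = - \<Xi>'' A h h\<close> cancels the curvature of \<open>\<Xi>\<close>, so that the parabola with direction \<open>h\<close> and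
  acceleration \<open>w\<close> is mapped to a ray of the cone up to second order.
\<close>

theorem cone_reducible_curvature:
  fixes K :: "'b::euclidean_space set" and t :: "nat \<Rightarrow> real"
  assumes red: "C2_cone_reducible_at K A"
    and y: "\<And>n. y n \<in> normal_cone K (z n)" "y \<longlonglongrightarrow> y0"
    and t: "\<And>n. t n > 0" "t \<longlonglongrightarrow> 0" and h: "(\<lambda>n. (z n - A) /\<^sub>R t n) \<longlonglongrightarrow> h"
  obtains w r where "w \<in> second_order_tangent_set K A h" "strict_mono r"
    "(\<lambda>n. y (r n) \<bullet> (A - z (r n)) / (t (r n))\<^sup>2) \<longlonglongrightarrow> (1 / 2) * (y0 \<bullet> w)"
proof -
  obtain W C :: "'b set" and \<Xi> :: "'b \<Rightarrow> 'b" and \<Xi>' \<Xi>'' where RC: "regular_constraint \<Xi> \<Xi>' W C A" and C: "cone C" and \<Xi>A: "\<Xi> A = 0"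
    and d2: "\<And>x. x \<in> W \<Longrightarrow> (\<Xi>' has_derivative blinfun_apply (\<Xi>'' x)) (at x)"
    and c2: "continuous_on W \<Xi>''" and KW: "K \<inter> W = {B \<in> W. \<Xi> B \<in> C}"
    and surj: "\<And>h. \<exists>w. \<Xi>' A w = \<Xi>'' A h h"
    by (rule cone_reducible_regular_constraint[OF red]) (rule that)
  interpret R: regular_constraint \<Xi> \<Xi>' W C A by (rule RC)
  note taylor = C2_taylor_limit[OF R.open_W R.x0_in_W R.deriv d2 c2]
  have zA: "z \<longlonglongrightarrow> A"
  proof -
    have "(\<lambda>n. A + t n *\<^sub>R ((z n - A) /\<^sub>R t n)) \<longlonglongrightarrow> A + 0 *\<^sub>R h"
      by (intro tendsto_intros t h)
    moreover have "A + t n *\<^sub>R ((z n - A) /\<^sub>R t n) = z n" for n using t(1)[of n] by simp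
    ultimately show ?thesis by simp
  qed
  obtain \<delta> where \<delta>: "\<delta> > 0" "cball A \<delta> \<subseteq> W"
    "\<And>x b. dist x A \<le> \<delta> \<Longrightarrow> norm b \<le> \<delta> \<Longrightarrow> \<Xi> x + b \<in> C \<Longrightarrow> regular_constraint (\<lambda>u. \<Xi> u + b) \<Xi>' W C x"
    using R.regular_nearby by metis
  \<comment> \<open>The point \<open>z n\<close> maximises \<open>y n \<bullet> u\<close> over \<open>K\<close>, and near \<open>A\<close> this is a problem with the
    constraint \<open>\<Xi> u \<in> C\<close>; \<open>m n\<close> is its multiplier.\<close>
  have "\<exists>m. m \<in> normal_cone C (\<Xi> (z n)) \<and> (\<forall>k. y n \<bullet> k = m \<bullet> \<Xi>' (z n) k)"
    if "dist (z n) A < \<delta>" for n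
  proof -
    have zW: "z n \<in> W" using that \<delta> by (auto simp: dist_commute subset_iff)
    have zK: "z n \<in> K" using normal_cone_base[OF y(1)] .
    then have "\<Xi> (z n) \<in> C" using KW zW by blast
    then interpret S: regular_constraint \<Xi> \<Xi>' W C "z n"
      using \<delta>(3)[of "z n" 0] that \<delta>(1) by simp
    obtain m where m: "m \<in> normal_cone C (\<Xi> (z n))"
      "\<And>k. (- blinfun_inner_right (y n)) k + m \<bullet> \<Xi>' (z n) k = 0"
    proof (rule S.multiplier_exists[of "\<lambda>u. - (y n \<bullet> u)" "\<lambda>_. - blinfun_inner_right (y n)" UNIV])
      show "((\<lambda>u. - (y n \<bullet> u)) has_derivative blinfun_apply (- blinfun_inner_right (y n))) (at x)" for x
        by (auto intro!: derivative_eq_intros simp: blinfun.minus_left blinfun_inner_right.rep_eq)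
      show "- (y n \<bullet> z n) \<le> - (y n \<bullet> u)" if "u \<in> W \<inter> UNIV" "\<Xi> u \<in> C" for u
        using normal_coneD[OF y(1), of u n] KW that by (auto simp: inner_diff_right)
    qed auto
    then show ?thesis
      by (intro exI[of _ m]) (auto simp: blinfun.minus_left blinfun_inner_right.rep_eq)
  qed
  then obtain m where m: "\<And>n. dist (z n) A < \<delta> \<Longrightarrow> m n \<in> normal_cone C (\<Xi> (z n))"
    "\<And>n k. dist (z n) A < \<delta> \<Longrightarrow> y n \<bullet> k = m n \<bullet> \<Xi>' (z n) k"
    by metis
  obtain c \<eta> where c: "c > 0" "\<eta> > 0" and dual:
    "\<And>x p y e. dist x A < \<eta> \<Longrightarrow> dist p (\<Xi> A) < \<eta> \<Longrightarrow> y \<in> normal_cone C p \<Longrightarrow>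
      (\<And>h. \<bar>y \<bullet> \<Xi>' x h\<bar> \<le> e * norm h) \<Longrightarrow> c * norm y \<le> e"
    using R.uniform_dual_bound by metis
  have \<Xi>z: "(\<lambda>n. \<Xi> (z n)) \<longlonglongrightarrow> \<Xi> A"
    by (rule isCont_tendsto_compose[OF R.isCont_g[OF R.x0_in_W] zA])
  have near: "\<forall>\<^sub>F n in sequentially. dist (z n) A < \<delta>" by (rule tendstoD[OF zA \<delta>(1)])
  have "\<forall>\<^sub>F n in sequentially. norm (y n) < norm y0 + 1"
    by (rule order_tendstoD[OF tendsto_norm[OF y(2)]]) simp
  then have "\<forall>\<^sub>F n in sequentially. norm (m n) \<le> (norm y0 + 1) / c"
    using near tendstoD[OF zA c(2)] tendstoD[OF \<Xi>z c(2)]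
  proof eventually_elim
    case (elim n)
    have "c * norm (m n) \<le> norm (y n)"
      using elim m(2)[OF elim(2)] by (intro dual[OF _ _ m(1)]) (auto simp: Cauchy_Schwarz_ineq2 simp flip: m(2)[OF elim(2)])
    then show ?case using elim(1) c(1) by (simp add: field_simps)
  qed
  then obtain r \<mu> where r: "strict_mono r" and \<mu>: "(\<lambda>n. m (r n)) \<longlonglongrightarrow> \<mu>"
    by (rule eventually_bounded_convergent_subsequence)
  note sub = LIMSEQ_subseq_LIMSEQ[OF _ r, unfolded o_def]
  have near_r: "\<forall>\<^sub>F n in sequentially. dist (z (r n)) A < \<delta>"
    by (rule tendstoD[OF sub[OF zA] \<delta>(1)])
  have y0: "y0 \<bullet> k = \<mu> \<bullet> \<Xi>' A k" for k
  proof (rule LIMSEQ_unique)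
    show "(\<lambda>n. y (r n) \<bullet> k) \<longlonglongrightarrow> y0 \<bullet> k" by (intro tendsto_intros sub y)
    have "(\<lambda>n. m (r n) \<bullet> \<Xi>' (z (r n)) k) \<longlonglongrightarrow> \<mu> \<bullet> \<Xi>' A k"
      by (intro tendsto_intros \<mu> isCont_tendsto_compose[OF R.isCont_g'[OF R.x0_in_W] sub[OF zA]])
    then show "(\<lambda>n. y (r n) \<bullet> k) \<longlonglongrightarrow> \<mu> \<bullet> \<Xi>' A k"
      by (rule Lim_transform_eventually) (use near_r in eventually_elim, simp add: m(2))
  qed
  obtain w0 where w0: "\<Xi>' A w0 = \<Xi>'' A h h" using surj by blast
  define w where "w = - w0"
  have \<Xi>w: "\<Xi>' A w = - \<Xi>'' A h h" by (simp add: w_def w0 blinfun.minus_right)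

  have q: "\<Xi>' A h \<in> C"
  proof -
    have lim: "(\<lambda>n. \<Xi> (z n) /\<^sub>R t n) \<longlonglongrightarrow> \<Xi>' A h"
      using C2_difference_quotient_limit[OF R.open_W R.x0_in_W R.deriv d2 c2 zA t h] \<Xi>A by simp
    have "\<forall>\<^sub>F n in sequentially. \<Xi> (z n) /\<^sub>R t n \<in> C"
      using near
    proof eventually_elim
      case (elim n)
      then have "\<Xi> (z n) \<in> C" using normal_cone_base[OF m(1)] by simp
      then show ?case using C t(1)[of n] by (simp add: cone_def less_imp_le)
    qed
    then show ?thesis by (rule Lim_in_closed_set[OF R.closed_K _ _ lim]) simp
  qed

  \<comment> \<open>Metric regularity of the reduced constraint converts a residual of order \<open>o(\<tau>\<^sup>2)\<close> in the cone
    into a distance of that order from \<open>K\<close>.\<close>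
  have tangent: "w \<in> second_order_tangent_set K A h"
  proof -
    define \<tau> where "\<tau> n = inverse (real (Suc n))" for n
    have \<tau>: "\<And>n. \<tau> n > 0" "\<tau> \<longlonglongrightarrow> 0"
      using LIMSEQ_inverse_real_of_nat by (auto simp: \<tau>_def[abs_def])
    define u where "u n = A + \<tau> n *\<^sub>R h + (1 / 2 * (\<tau> n)\<^sup>2) *\<^sub>R w" for n
    have "u \<longlonglongrightarrow> A + 0 *\<^sub>R h + (1 / 2 * 0\<^sup>2) *\<^sub>R w"
      unfolding u_def by (intro tendsto_intros \<tau>)
    then have uA: "u \<longlonglongrightarrow> A" by simp
    have uq: "(u n - A) /\<^sub>R \<tau> n = h + (1 / 2 * \<tau> n) *\<^sub>R w" for n
      using \<tau>(1)[of n] by (simp add: u_def scaleR_add_right power2_eq_square)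
    have "(\<lambda>n. h + (1 / 2 * \<tau> n) *\<^sub>R w) \<longlonglongrightarrow> h + (1 / 2 * 0) *\<^sub>R w"
      by (intro tendsto_intros \<tau>)
    then have "(\<lambda>n. (u n - A) /\<^sub>R \<tau> n) \<longlonglongrightarrow> h" unfolding uq by simp
    from taylor[OF _ _ uA tendsto_const \<tau>(1) this]
    have "(\<lambda>n. (\<Xi> (u n) - \<Xi> A - \<Xi>' A (u n - A)) /\<^sub>R (\<tau> n)\<^sup>2 - (1 / 2) *\<^sub>R \<Xi>'' A h h) \<longlonglongrightarrow>
        (1 / 2) *\<^sub>R \<Xi>'' A h h - (1 / 2) *\<^sub>R \<Xi>'' A h h"
      by (intro tendsto_diff tendsto_const)
    moreover have "(\<Xi> (u n) - \<Xi> A - \<Xi>' A (u n - A)) /\<^sub>R (\<tau> n)\<^sup>2 - (1 / 2) *\<^sub>R \<Xi>'' A h h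
        = (\<Xi> (u n) - \<tau> n *\<^sub>R \<Xi>' A h) /\<^sub>R (\<tau> n)\<^sup>2" for n
    proof -
      have eq: "\<Xi>' A (u n - A) = \<tau> n *\<^sub>R \<Xi>' A h - (1 / 2 * (\<tau> n)\<^sup>2) *\<^sub>R \<Xi>'' A h h"
        by (simp add: u_def blinfun.add_right blinfun.scaleR_right \<Xi>w)
      show ?thesis unfolding eq using \<tau>(1)[of n] by (simp add: \<Xi>A scaleR_diff_right)
    qed
    ultimately have res: "(\<lambda>n. (\<Xi> (u n) - \<tau> n *\<^sub>R \<Xi>' A h) /\<^sub>R (\<tau> n)\<^sup>2) \<longlonglongrightarrow> 0" by simp
    obtain \<kappa> \<rho> where \<kappa>: "\<kappa> > 0" "\<rho> > 0" and reg:
      "\<And>x b. dist x A < \<rho> \<Longrightarrow> norm b < \<rho> \<Longrightarrow> \<exists>u\<in>W. \<Xi> u + b \<in> C \<and> dist u x \<le> \<kappa> * infdist (\<Xi> x + b) C"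
      using R.metric_regularity by metis
    have "(\<lambda>n. infdist (u n) K) \<in> o(\<lambda>n. (\<tau> n)\<^sup>2)"
    proof (rule landau_o.smallI)
      fix e :: real assume "e > 0"
      then have "e / \<kappa> > 0" using \<kappa> by simp
      show "\<forall>\<^sub>F n in sequentially. norm (infdist (u n) K) \<le> e * norm ((\<tau> n)\<^sup>2)"
        using tendstoD[OF res \<open>e / \<kappa> > 0\<close>] tendstoD[OF uA \<kappa>(2)]
      proof eventually_elim
        case (elim n)
        obtain x where x: "x \<in> W" "\<Xi> x \<in> C" "dist x (u n) \<le> \<kappa> * infdist (\<Xi> (u n)) C"
          using reg[OF elim(2), of 0] \<kappa>(2) by auto
        have "\<tau> n *\<^sub>R \<Xi>' A h \<in> C" using C q \<tau>(1)[of n] by (simp add: cone_def less_imp_le)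
        then have "infdist (\<Xi> (u n)) C \<le> norm (\<Xi> (u n) - \<tau> n *\<^sub>R \<Xi>' A h)"
          using infdist_le by (metis dist_norm)
        also have "norm (\<Xi> (u n) - \<tau> n *\<^sub>R \<Xi>' A h) / (\<tau> n)\<^sup>2 < e / \<kappa>"
          using elim(1) by (simp add: divide_inverse mult.commute)
        then have "norm (\<Xi> (u n) - \<tau> n *\<^sub>R \<Xi>' A h) \<le> e / \<kappa> * (\<tau> n)\<^sup>2"
          using \<tau>(1)[of n] by (simp add: pos_divide_less_eq)
        finally have "\<kappa> * infdist (\<Xi> (u n)) C \<le> e * (\<tau> n)\<^sup>2"
          using \<kappa>(1) by (simp add: field_simps)
        moreover have "x \<in> K" using x KW by blast
        then have "infdist (u n) K \<le> dist x (u n)" by (metis infdist_le dist_commute)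
        ultimately show ?case using x(3) by (simp add: infdist_nonneg)
      qed
    qed
    then show ?thesis using \<tau> unfolding second_order_tangent_set_def u_def by blast
  qed

  have "(\<lambda>n. (A - z (r n)) /\<^sub>R t (r n)) \<longlonglongrightarrow> - h"
  proof -
    have "(\<lambda>n. - ((z (r n) - A) /\<^sub>R t (r n))) \<longlonglongrightarrow> - h"
      by (intro tendsto_intros sub[OF h])
    then show ?thesis by (simp add: scaleR_diff_right)
  qed
  note T = taylor[OF _ _ tendsto_const sub[OF zA] t(1) this]
  have "(\<lambda>n. - (m (r n) \<bullet> ((\<Xi> A - \<Xi> (z (r n)) - \<Xi>' (z (r n)) (A - z (r n))) /\<^sub>R (t (r n))\<^sup>2)))
      \<longlonglongrightarrow> - (\<mu> \<bullet> ((1 / 2) *\<^sub>R \<Xi>'' A (- h) (- h)))"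
    by (intro tendsto_minus tendsto_inner[OF \<mu> T])
  moreover have "- (\<mu> \<bullet> ((1 / 2) *\<^sub>R \<Xi>'' A (- h) (- h))) = 1 / 2 * (y0 \<bullet> w)"
    by (simp add: y0 \<Xi>w blinfun.minus_right blinfun.minus_left)
  ultimately have "(\<lambda>n. - (m (r n) \<bullet> ((\<Xi> A - \<Xi> (z (r n)) - \<Xi>' (z (r n)) (A - z (r n))) /\<^sub>R (t (r n))\<^sup>2)))
      \<longlonglongrightarrow> 1 / 2 * (y0 \<bullet> w)" by (simp only:)
  then have "(\<lambda>n. y (r n) \<bullet> (A - z (r n)) / (t (r n))\<^sup>2) \<longlonglongrightarrow> 1 / 2 * (y0 \<bullet> w)"
  proof (rule Lim_transform_eventually)
    show "\<forall>\<^sub>F n in sequentially. - (m (r n) \<bullet> ((\<Xi> A - \<Xi> (z (r n)) - \<Xi>' (z (r n)) (A - z (r n))) /\<^sub>R (t (r n))\<^sup>2))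
        = y (r n) \<bullet> (A - z (r n)) / (t (r n))\<^sup>2"
      using near_r
    proof eventually_elim
      case (elim n)
      have "m (r n) \<bullet> \<Xi> (z (r n)) = 0"
        by (rule normal_cone_of_cone_orthogonal[OF C m(1)[OF elim]])
      then show ?case
        using m(2)[OF elim, of "A - z (r n)"] by (simp add: \<Xi>A inner_diff_right divide_inverse)
    qed
  qed
  with tangent r show ?thesis by (rule that)
qed

section \<open>The stationarity system\<close>

lemma gradient_inner:
  fixes \<phi> :: "'a::euclidean_space \<Rightarrow> real"
  assumes "(\<phi> has_derivative \<phi>') (at x)"
  shows "gradient \<phi> x \<bullet> h = \<phi>' h"
proof -
  have adj: "\<phi>' h = h \<bullet> adjoint \<phi>' 1" for h
    using adjoint_works[OF has_derivative_linear[OF assms], of h 1] by simp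
  then have "GDERIV \<phi> x :> adjoint \<phi>' 1"
    using assms unfolding gderiv_def by (metis (no_types, lifting) ext)
  then show ?thesis by (simp add: gradient_eqI adj inner_commute)
qed

lemma hessian_inner:
  fixes \<phi> :: "'a::euclidean_space \<Rightarrow> real"
  assumes \<phi>': "\<And>u. (\<phi> has_derivative blinfun_apply (\<phi>' u)) (at u)"
    and D: "(\<phi>' has_derivative D) (at x)"
  shows "k \<bullet> hessian \<phi> x h = D h k"
proof -
  have "gradient \<phi> = (\<lambda>u. \<Sum>b\<in>Basis. \<phi>' u b *\<^sub>R b)"
    by (rule ext) (simp add: gradient_inner[OF \<phi>', symmetric] euclidean_representation)
  moreover have "((\<lambda>u. \<Sum>b\<in>Basis. \<phi>' u b *\<^sub>R b) has_derivative (\<lambda>h. \<Sum>b\<in>Basis. D h b *\<^sub>R b)) (at x)"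
    by (auto intro!: derivative_eq_intros D)
  ultimately have "(gradient \<phi> has_derivative (\<lambda>h. \<Sum>b\<in>Basis. D h b *\<^sub>R b)) (at x)"
    by simp
  from frechet_derivative_at[OF this]
  have "hessian \<phi> x = (\<lambda>h. \<Sum>b\<in>Basis. D h b *\<^sub>R b)"
    by (simp add: hessian_def)
  then have "k \<bullet> hessian \<phi> x h = (\<Sum>b\<in>Basis. D h ((k \<bullet> b) *\<^sub>R b))"
    by (simp add: inner_sum_right blinfun.scaleR_right mult.commute)
  also have "\<dots> = D h (\<Sum>b\<in>Basis. (k \<bullet> b) *\<^sub>R b)" by (simp add: blinfun.sum_right)
  finally show ?thesis by (simp add: euclidean_representation)
qed

lemma hessian_lagrangian:
  fixes f :: "'a::euclidean_space \<Rightarrow> real" and G :: "'a \<Rightarrow> 'b::euclidean_space"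
  assumes "\<And>u. (f has_derivative blinfun_apply (f' u)) (at u)" "(f' has_derivative blinfun_apply f'') (at x)"
    and "\<And>u. (G has_derivative blinfun_apply (G' u)) (at u)" "(G' has_derivative blinfun_apply G'') (at x)"
  shows "k \<bullet> hessian (\<lambda>u. lagrangian f G u y) x h = f'' h k + y \<bullet> G'' h k"
proof -
  define l where "l u = f' u + (blinfun_inner_right y o\<^sub>L G' u)" for u
  have "((\<lambda>u. lagrangian f G u y) has_derivative blinfun_apply (l u)) (at u)" for u
  proof -
    have "((\<lambda>u. f u + y \<bullet> G u) has_derivative (\<lambda>h. f' u h + y \<bullet> G' u h)) (at u)"
      by (intro has_derivative_add has_derivative_inner_right assms)
    moreover have "(\<lambda>h. f' u h + y \<bullet> G' u h) = blinfun_apply (l u)"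
      by (simp add: l_def fun_eq_iff blinfun.add_left blinfun_inner_right.rep_eq)
    ultimately show ?thesis by (simp add: lagrangian_def)
  qed
  moreover have "(l has_derivative (\<lambda>h. f'' h + (blinfun_inner_right y o\<^sub>L G'' h))) (at x)"
    unfolding l_def
    by (rule has_derivative_add[OF assms(2) bounded_linear.has_derivative[OF
          bounded_bilinear.bounded_linear_right[OF bounded_bilinear_blinfun_compose] assms(4)]])
  ultimately show ?thesis
    by (subst hessian_inner) (auto simp: blinfun.add_left blinfun_inner_right.rep_eq)
qed

lemma S_KKT_iff:
  fixes f :: "'a::euclidean_space \<Rightarrow> real" and G :: "'a \<Rightarrow> 'b::euclidean_space"
  assumes f': "(f has_derivative f') (at x)" and G': "(G has_derivative G') (at x)"
  shows "(x, y) \<in> S_KKT f G K a b \<longleftrightarrow> (\<forall>h. f' h + y \<bullet> G' h = a \<bullet> h) \<and> y \<in> normal_cone K (G x + b)"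
proof -
  have "((\<lambda>u. lagrangian f G u y) has_derivative (\<lambda>h. f' h + y \<bullet> G' h)) (at x)"
    unfolding lagrangian_def by (intro has_derivative_add has_derivative_inner_right assms)
  note g = gradient_inner[OF this]
  have "a = gradient (\<lambda>u. lagrangian f G u y) x \<longleftrightarrow> (\<forall>h. f' h + y \<bullet> G' h = a \<bullet> h)"
    by (metis g vector_eq_ldot inner_commute)
  then show ?thesis by (simp add: S_KKT_def)
qed

lemma neighbourhood_by_sequences:
  fixes p :: "'a::metric_space"
  assumes "\<And>s. s \<longlonglongrightarrow> p \<Longrightarrow> (\<And>n::nat. \<not> Q (s n)) \<Longrightarrow> False"
  shows "\<exists>U. open U \<and> p \<in> U \<and> (\<forall>p'\<in>U. Q p')"
proof (rule ccontr)
  assume no: "\<not> ?thesis"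
  have "\<exists>x. dist x p < inverse (real (Suc n)) \<and> \<not> Q x" for n
  proof (rule ccontr)
    assume "\<not> ?thesis"
    then have "\<forall>x\<in>ball p (inverse (real (Suc n))). Q x" by (auto simp: dist_commute)
    then show False using no by (metis centre_in_ball inverse_positive_iff_positive of_nat_0_less_iff open_ball zero_less_Suc)
  qed
  then obtain s where s: "\<And>n. dist (s n) p < inverse (real (Suc n))" "\<And>n. \<not> Q (s n)" by metis
  have "s \<longlonglongrightarrow> p"
    by (rule metric_tendsto_imp_tendsto[OF LIMSEQ_inverse_real_of_nat]) (use s(1) in \<open>auto simp: less_imp_le\<close>)
  then show False using assms s(2) by blast
qed

section \<open>Isolation and stability of stationary points\<close>

locale regular_problem = regular_constraint G G' UNIV K xbar
  for G :: "'a::euclidean_space \<Rightarrow> 'b::euclidean_space" and G' K xbar +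
  fixes f :: "'a \<Rightarrow> real" and f' :: "'a \<Rightarrow> 'a \<Rightarrow>\<^sub>L real"
  assumes f_deriv: "\<And>x. (f has_derivative blinfun_apply (f' x)) (at x)"
    and f'_cont: "continuous_on UNIV f'"
begin

lemma KKT_iff: "(x, y) \<in> S_KKT f G K a b \<longleftrightarrow>
    (\<forall>h. f' x h + y \<bullet> G' x h = a \<bullet> h) \<and> y \<in> normal_cone K (G x + b)"
  by (rule S_KKT_iff[OF f_deriv deriv[OF UNIV_I]])

lemma isCont_f': "isCont f' x"
  using f'_cont by (simp add: continuous_on_eq_continuous_at)

lemma isCont_f: "isCont f x"
  by (rule has_derivative_continuous[OF f_deriv])

text \<open>
  The graph of the stationarity system is closed, and near a regular point the multipliers are bounded,
  by the uniform estimate.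
\<close>

lemma KKT_limit:
  assumes kkt: "\<And>n. (X n, Y n) \<in> S_KKT f G K (a n) (b n)"
    and X: "X \<longlonglongrightarrow> x" and a: "a \<longlonglongrightarrow> a0" and b: "b \<longlonglongrightarrow> b0"
    and reg: "regular_constraint (\<lambda>u. G u + b0) G' UNIV K x"
  obtains r y where "strict_mono r" "(\<lambda>n. Y (r n)) \<longlonglongrightarrow> y" "(x, y) \<in> S_KKT f G K a0 b0"
proof -
  interpret S: regular_constraint "\<lambda>u. G u + b0" G' UNIV K x by (rule reg)
  obtain c \<delta> where c: "c > 0" "\<delta> > 0" and dual:
    "\<And>x' p y e. dist x' x < \<delta> \<Longrightarrow> dist p (G x + b0) < \<delta> \<Longrightarrow> y \<in> normal_cone K p \<Longrightarrow>
      (\<And>h. \<bar>y \<bullet> G' x' h\<bar> \<le> e * norm h) \<Longrightarrow> c * norm y \<le> e"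
    using S.uniform_dual_bound by metis
  have GX: "(\<lambda>n. G (X n) + b n) \<longlonglongrightarrow> G x + b0"
    by (intro tendsto_intros b isCont_tendsto_compose[OF isCont_g X]) simp
  have f'X: "(\<lambda>n. f' (X n)) \<longlonglongrightarrow> f' x"
    by (rule isCont_tendsto_compose[OF isCont_f' X])
  have G'X: "(\<lambda>n. G' (X n)) \<longlonglongrightarrow> G' x"
    by (rule isCont_tendsto_compose[OF isCont_g' X]) simp
  have "(\<lambda>n. norm (a n) + norm (f' (X n))) \<longlonglongrightarrow> norm a0 + norm (f' x)"
    by (intro tendsto_intros a f'X)
  then have "\<forall>\<^sub>F n in sequentially. norm (a n) + norm (f' (X n)) < norm a0 + norm (f' x) + 1"
    by (rule order_tendstoD) simp
  then have "\<forall>\<^sub>F n in sequentially. norm (Y n) \<le> (norm a0 + norm (f' x) + 1) / c"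
    using tendstoD[OF X c(2)] tendstoD[OF GX c(2)]
  proof eventually_elim
    case (elim n)
    have Y: "Y n \<in> normal_cone K (G (X n) + b n)" and st: "f' (X n) h + Y n \<bullet> G' (X n) h = a n \<bullet> h" for h
      using kkt KKT_iff by blast+
    have "\<bar>Y n \<bullet> G' (X n) h\<bar> \<le> (norm (a n) + norm (f' (X n))) * norm h" for h
      using st[of h] Cauchy_Schwarz_ineq2[of "a n" h] norm_blinfun[of "f' (X n)" h]
      by (simp add: algebra_simps)
    then have "c * norm (Y n) \<le> norm (a n) + norm (f' (X n))"
      by (intro dual[OF elim(2,3) Y])
    then show ?case using elim(1) c(1) by (simp add: field_simps)
  qed
  then obtain r y where r: "strict_mono r" and y: "(\<lambda>n. Y (r n)) \<longlonglongrightarrow> y"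
    by (rule eventually_bounded_convergent_subsequence)
  note sub = LIMSEQ_subseq_LIMSEQ[OF _ r, unfolded o_def]
  have "y \<in> normal_cone K (G x + b0)"
    by (rule normal_cone_limit[OF closed_K _ y sub[OF GX]]) (use kkt KKT_iff in auto)
  moreover have "f' x h + y \<bullet> G' x h = a0 \<bullet> h" for h
  proof (rule LIMSEQ_unique)
    show "(\<lambda>n. a (r n) \<bullet> h) \<longlonglongrightarrow> a0 \<bullet> h" by (intro tendsto_intros sub a)
    have "(\<lambda>n. f' (X (r n)) h + Y (r n) \<bullet> G' (X (r n)) h) \<longlonglongrightarrow> f' x h + y \<bullet> G' x h"
      by (intro tendsto_intros y sub[OF f'X] sub[OF G'X])
    moreover have "f' (X (r n)) h + Y (r n) \<bullet> G' (X (r n)) h = a (r n) \<bullet> h" for n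
      using kkt KKT_iff by blast
    ultimately show "(\<lambda>n. a (r n) \<bullet> h) \<longlonglongrightarrow> f' x h + y \<bullet> G' x h" by simp
  qed
  ultimately show ?thesis using r y by (intro that) (auto simp: KKT_iff)
qed

lemma local_min_stationary:
  assumes reg: "regular_constraint (\<lambda>u. G u + b) G' UNIV K x"
    and U: "open U" "x \<in> U" and min: "\<And>u. u \<in> U \<Longrightarrow> G u + b \<in> K \<Longrightarrow> f x - a \<bullet> x \<le> f u - a \<bullet> u"
  shows "x \<in> X_KKT f G K a b"
proof -
  interpret S: regular_constraint "\<lambda>u. G u + b" G' UNIV K x by (rule reg)
  obtain y where y: "y \<in> normal_cone K (G x + b)" "\<And>h. (f' x - blinfun_inner_right a) h + y \<bullet> G' x h = 0"
  proof (rule S.multiplier_exists[of "\<lambda>u. f u - a \<bullet> u" "\<lambda>u. f' u - blinfun_inner_right a" U])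
    show "((\<lambda>u. f u - a \<bullet> u) has_derivative blinfun_apply (f' x - blinfun_inner_right a)) (at x)" for x
      by (auto intro!: derivative_eq_intros f_deriv simp: blinfun.diff_left blinfun_inner_right.rep_eq)
    show "continuous_on UNIV (\<lambda>u. f' u - blinfun_inner_right a)"
      by (intro continuous_intros f'_cont)
  qed (use U min in auto)
  have "f' x h + y \<bullet> G' x h = a \<bullet> h" for h
    using y(2)[of h] by (simp add: blinfun.diff_left blinfun_inner_right.rep_eq)
  then have "(x, y) \<in> S_KKT f G K a b" using y(1) KKT_iff by blast
  then show ?thesis by (auto simp: X_KKT_def)
qed

text \<open>
  Suppose stationary points \<open>X n \<noteq> xbar\<close> at distance \<open>t n\<close> converge to \<open>xbar\<close>, with directions
  \<open>(X n - xbar) /\<^sub>R t n\<close> converging to \<open>d\<close> and multipliers \<open>Y n\<close> converging to \<open>y\<close>. Then \<open>d\<close> is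
  critical and \<open>y\<close> is a multiplier at \<open>xbar\<close>. Expanding the Lagrangian with multiplier \<open>Y n\<close> at its
  stationary point \<open>X n\<close>, instead of at \<open>xbar\<close>, shows that
  \<open>f xbar - f (X n) + Y n \<bullet> (G xbar - G (X n))\<close> is \<open>(t n)\<^sup>2 / 2\<close> times \<open>H + o(1)\<close>, where \<open>H\<close> is the
  value at \<open>d\<close> of the Hessian form for \<open>y\<close>. Along a subsequence, by the curvature theorem, the inner
  product is \<open>(t n)\<^sup>2 / 2\<close> times \<open>y \<bullet> w + o(1)\<close> for some \<open>w\<close> in the second-order tangent set, and the
  sufficient condition gives \<open>H > y \<bullet> w\<close>. So \<open>f (X n) < f xbar\<close> at feasible points arbitrarily close to
  a local minimiser.
\<close>

theorem stationary_point_isolated: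
  assumes f'': "\<And>x. (f' has_derivative blinfun_apply (f'' x)) (at x)" "continuous_on UNIV f''"
    and G'': "\<And>x. (G' has_derivative blinfun_apply (G'' x)) (at x)" "continuous_on UNIV G''"
    and red: "C2_cone_reducible_at K (G xbar)"
    and opt: "locally_optimal f G K 0 0 xbar"
    and sosc: "robinson_SOSC f G K xbar"
  shows "\<exists>\<rho>>0. \<forall>x. dist x xbar < \<rho> \<longrightarrow> x \<in> X_KKT f G K 0 0 \<longrightarrow> x = xbar"
proof (rule ccontr)
  assume no: "\<not> ?thesis"
  have "\<exists>x. dist x xbar < e \<and> x \<noteq> xbar \<and> x \<in> X_KKT f G K 0 0" if "e > 0" for e
    using no that by blast
  then have "\<exists>x y. dist x xbar < inverse (real (Suc n)) \<and> x \<noteq> xbar \<and> (x, y) \<in> S_KKT f G K 0 0" for n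
    unfolding X_KKT_def mem_Collect_eq by (metis inverse_positive_iff_positive of_nat_0_less_iff zero_less_Suc)
  then obtain X0 Y0 where X0: "\<And>n. dist (X0 n) xbar < inverse (real (Suc n))" "\<And>n. X0 n \<noteq> xbar"
    and KKT0: "\<And>n. (X0 n, Y0 n) \<in> S_KKT f G K 0 0" by metis
  have X0lim: "X0 \<longlonglongrightarrow> xbar"
    by (rule metric_tendsto_imp_tendsto[OF LIMSEQ_inverse_real_of_nat]) (use X0(1) in \<open>auto simp: less_imp_le\<close>)
  have reg0: "regular_constraint (\<lambda>u. G u + 0) G' UNIV K xbar"
    using regular_constraint_axioms by simp
  obtain r y where r: "strict_mono r" and Yr: "(\<lambda>n. Y0 (r n)) \<longlonglongrightarrow> y" and y: "(xbar, y) \<in> S_KKT f G K 0 0"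
    by (rule KKT_limit[OF KKT0 X0lim tendsto_const tendsto_const reg0])
  define d0 where "d0 n = (X0 n - xbar) /\<^sub>R norm (X0 n - xbar)" for n
  have nd0: "norm (d0 n) = 1" for n using X0(2)[of n] by (simp add: d0_def)
  have "\<forall>\<^sub>F n in sequentially. norm (d0 (r n)) \<le> 1" by (simp add: nd0)
  then obtain q d where q: "strict_mono q" and dlim: "(\<lambda>n. d0 (r (q n))) \<longlonglongrightarrow> d"
    by (rule eventually_bounded_convergent_subsequence)
  have rq: "strict_mono (\<lambda>n. r (q n))" using r q by (simp add: strict_mono_def)
  define X Y t where "X n = X0 (r (q n))" and "Y n = Y0 (r (q n))" and "t n = norm (X n - xbar)" for n
  have X: "X \<longlonglongrightarrow> xbar" and Y: "Y \<longlonglongrightarrow> y" and D: "(\<lambda>n. (X n - xbar) /\<^sub>R t n) \<longlonglongrightarrow> d"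
    using LIMSEQ_subseq_LIMSEQ[OF X0lim rq] LIMSEQ_subseq_LIMSEQ[OF Yr q] dlim
    by (simp_all add: o_def X_def[abs_def] Y_def[abs_def] t_def d0_def)
  have t0: "t n > 0" for n using X0(2) by (simp add: t_def X_def)
  have "t \<longlonglongrightarrow> norm (xbar - xbar)" unfolding t_def by (intro tendsto_intros X)
  then have tlim: "t \<longlonglongrightarrow> 0" by simp
  have "norm d = 1"
    using tendsto_norm[OF dlim] nd0 by (simp add: LIMSEQ_const_iff)
  then have "d \<noteq> 0" by auto
  have st: "f' (X n) h + Y n \<bullet> G' (X n) h = 0" and YN: "Y n \<in> normal_cone K (G (X n))" for n h
    using KKT0[of "r (q n)"] by (auto simp: KKT_iff X_def Y_def)
  have sty: "f' xbar h + y \<bullet> G' xbar h = 0" for h using y by (simp add: KKT_iff)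
  have GXK: "G (X n) \<in> K" for n by (rule normal_cone_base[OF YN])
  have GX: "(\<lambda>n. G (X n)) \<longlonglongrightarrow> G xbar"
    by (rule isCont_tendsto_compose[OF isCont_g X]) simp
  have Gq: "(\<lambda>n. (G (X n) - G xbar) /\<^sub>R t n) \<longlonglongrightarrow> G' xbar d"
    by (rule C2_difference_quotient_limit[OF open_UNIV UNIV_I deriv G'' X t0 tlim D]) simp
  have dG: "frechet_derivative G (at xbar) = blinfun_apply (G' xbar)"
    using frechet_derivative_at[OF deriv] by simp
  have df: "frechet_derivative f (at xbar) = blinfun_apply (f' xbar)"
    using frechet_derivative_at[OF f_deriv] by simp
  have crit: "d \<in> critical_cone f G K xbar"
  proof -
    have "G' xbar d \<in> tangent_cone K (G xbar)"
      unfolding tangent_cone_def using GX GXK t0 tlim Gq by blast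
    moreover have "0 \<le> y \<bullet> G' xbar d"
    proof (rule tendsto_lowerbound)
      show "(\<lambda>n. Y n \<bullet> ((G (X n) - G xbar) /\<^sub>R t n)) \<longlonglongrightarrow> y \<bullet> G' xbar d"
        by (rule tendsto_inner[OF Y Gq])
      have "0 \<le> Y n \<bullet> ((G (X n) - G xbar) /\<^sub>R t n)" for n
        using normal_coneD[OF YN feasible_x0, of n] t0[of n] by (simp add: inner_diff_right)
      then show "\<forall>\<^sub>F n in sequentially. 0 \<le> Y n \<bullet> ((G (X n) - G xbar) /\<^sub>R t n)" by simp
    qed simp
    ultimately show ?thesis using sty[of d] by (simp add: critical_cone_def dG df)
  qed
  obtain w s where w: "w \<in> second_order_tangent_set K (G xbar) (G' xbar d)" and s: "strict_mono s"
    and curv: "(\<lambda>n. Y (s n) \<bullet> (G xbar - G (X (s n))) / (t (s n))\<^sup>2) \<longlonglongrightarrow> (1 / 2) * (y \<bullet> w)"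
    by (rule cone_reducible_curvature[OF red YN Y t0 tlim Gq])
  define H where "H = f'' xbar d d + y \<bullet> G'' xbar d d"
  have hess: "d \<bullet> hessian (\<lambda>u. lagrangian f G u y) xbar d = H"
    unfolding H_def by (rule hessian_lagrangian[OF f_deriv f''(1) deriv[OF UNIV_I] G''(1)])
  have "d \<in> critical_cone f G K xbar - {0}" using crit \<open>d \<noteq> 0\<close> by blast
  with sosc[unfolded robinson_SOSC_def dG]
  have INF: "(INF y \<in> multipliers f G K xbar 0 0. ereal (d \<bullet> hessian (\<lambda>u. lagrangian f G u y) xbar d)
      - support_function y (second_order_tangent_set K (G xbar) (G' xbar d))) > 0"
    by (rule bspec)
  have "y \<in> multipliers f G K xbar 0 0" using y by (simp add: multipliers_def)
  from less_INF_D[OF INF this]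
  have sig: "ereal H - support_function y (second_order_tangent_set K (G xbar) (G' xbar d)) > 0"
    by (simp only: hess)
  have "ereal (y \<bullet> w) \<le> support_function y (second_order_tangent_set K (G xbar) (G' xbar d))"
    unfolding support_function_def using w by (intro SUP_upper)
  from less_le_trans[OF sig ereal_minus_mono[OF order_refl this]]
  have "ereal H - ereal (y \<bullet> w) > 0" .
  then have pos: "(1 / 2) * H - (1 / 2) * (y \<bullet> w) > 0" by simp
  have "(\<lambda>n. - ((X n - xbar) /\<^sub>R t n)) \<longlonglongrightarrow> - d"
    by (intro tendsto_intros D)
  then have D': "(\<lambda>n. (xbar - X n) /\<^sub>R t n) \<longlonglongrightarrow> - d" by (simp add: scaleR_diff_right)
  have Tf: "(\<lambda>n. (f xbar - f (X n) - f' (X n) (xbar - X n)) /\<^sub>R (t n)\<^sup>2) \<longlonglongrightarrow> (1 / 2) *\<^sub>R f'' xbar (- d) (- d)"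
    by (rule C2_taylor_limit[OF open_UNIV UNIV_I f_deriv f'' tendsto_const X t0 D'])
  have TG: "(\<lambda>n. (G xbar - G (X n) - G' (X n) (xbar - X n)) /\<^sub>R (t n)\<^sup>2) \<longlonglongrightarrow> (1 / 2) *\<^sub>R G'' xbar (- d) (- d)"
    by (rule C2_taylor_limit[OF open_UNIV UNIV_I deriv G'' tendsto_const X t0 D']) simp
  have "(\<lambda>n. (f xbar - f (X n) - f' (X n) (xbar - X n)) /\<^sub>R (t n)\<^sup>2
        + Y n \<bullet> ((G xbar - G (X n) - G' (X n) (xbar - X n)) /\<^sub>R (t n)\<^sup>2))
      \<longlonglongrightarrow> (1 / 2) *\<^sub>R f'' xbar (- d) (- d) + y \<bullet> ((1 / 2) *\<^sub>R G'' xbar (- d) (- d))"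
    by (intro tendsto_add Tf tendsto_inner[OF Y TG])
  moreover have "(1 / 2) *\<^sub>R f'' xbar (- d) (- d) + y \<bullet> ((1 / 2) *\<^sub>R G'' xbar (- d) (- d)) = (1 / 2) * H"
    by (simp add: H_def blinfun.minus_right blinfun.minus_left algebra_simps)
  moreover have "(f xbar - f (X n) - f' (X n) (xbar - X n)) /\<^sub>R (t n)\<^sup>2
        + Y n \<bullet> ((G xbar - G (X n) - G' (X n) (xbar - X n)) /\<^sub>R (t n)\<^sup>2)
      = (f xbar - f (X n)) / (t n)\<^sup>2 + Y n \<bullet> (G xbar - G (X n)) / (t n)\<^sup>2" for n
  proof -
    have "f' (X n) (xbar - X n) = - (Y n \<bullet> G' (X n) (xbar - X n))"
      using st[of n "xbar - X n"] by linarith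
    then show ?thesis by (simp add: inner_diff_right divide_inverse algebra_simps)
  qed
  ultimately have "(\<lambda>n. (f xbar - f (X n)) / (t n)\<^sup>2 + Y n \<bullet> (G xbar - G (X n)) / (t n)\<^sup>2) \<longlonglongrightarrow> (1 / 2) * H"
    by (simp only:)
  from tendsto_diff[OF LIMSEQ_subseq_LIMSEQ[OF this s, unfolded o_def] curv]
  have "(\<lambda>n. (f xbar - f (X (s n))) / (t (s n))\<^sup>2) \<longlonglongrightarrow> (1 / 2) * H - (1 / 2) * (y \<bullet> w)" by simp
  then have "\<forall>\<^sub>F n in sequentially. (f xbar - f (X (s n))) / (t (s n))\<^sup>2 > 0"
    using pos by (rule order_tendstoD)
  moreover obtain U where U: "open U" "xbar \<in> U" "\<And>u. u \<in> feasible G K 0 \<Longrightarrow> u \<in> U \<Longrightarrow> f xbar \<le> f u"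
    using opt unfolding locally_optimal_def by auto
  have "\<forall>\<^sub>F n in sequentially. X (s n) \<in> U"
    using LIMSEQ_subseq_LIMSEQ[OF X s, unfolded o_def] U(1,2) by (rule topological_tendstoD)
  ultimately have "\<forall>\<^sub>F n in sequentially. False"
  proof eventually_elim
    case (elim n)
    have "f xbar \<le> f (X (s n))" using U(3) elim(2) GXK by (simp add: feasible_def)
    then show False using elim(1) by (simp add: zero_less_divide_iff)
  qed
  then show False by simp
qed

text \<open>
  Upper semicontinuity: limits of stationary points of perturbed problems in a small ball are
  stationary for the unperturbed problem, hence equal to \<open>xbar\<close>. Lower semicontinuity: metric
  regularity supplies feasible points of the perturbed problems close to \<open>xbar\<close>, so minimisers over a
  small closed ball exist and accumulate only at minimisers of the unperturbed problem. The latter are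
  stationary, hence equal to \<open>xbar\<close>; so isolation replaces any growth condition. Eventually the
  perturbed minimisers lie in the interior of the ball and are stationary.
\<close>

theorem stationary_points_continuous:
  assumes opt: "locally_optimal f G K 0 0 xbar"
    and isolated: "\<exists>\<rho>>0. \<forall>x. dist x xbar < \<rho> \<longrightarrow> x \<in> X_KKT f G K 0 0 \<longrightarrow> x = xbar"
  shows "\<exists>V. open V \<and> xbar \<in> V \<and>
    set_continuous_at (\<lambda>(a, b). X_KKT f G K a b \<inter> V) (0, 0) xbar"
proof -
  obtain \<rho>0 where \<rho>0: "\<rho>0 > 0" "\<And>x. dist x xbar < \<rho>0 \<Longrightarrow> x \<in> X_KKT f G K 0 0 \<Longrightarrow> x = xbar"
    using isolated by blast
  obtain \<delta> where \<delta>: "\<delta> > 0" "\<And>x b. dist x xbar \<le> \<delta> \<Longrightarrow> norm b \<le> \<delta> \<Longrightarrow> G x + b \<in> K \<Longrightarrow>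
      regular_constraint (\<lambda>u. G u + b) G' UNIV K x"
    using regular_nearby by metis
  obtain U where U: "open U" "xbar \<in> U" "\<And>u. G u \<in> K \<Longrightarrow> u \<in> U \<Longrightarrow> f xbar \<le> f u"
    using opt unfolding locally_optimal_def feasible_def by auto
  obtain \<rho>1 where \<rho>1: "\<rho>1 > 0" "cball xbar \<rho>1 \<subseteq> U" using U open_contains_cball by blast
  define \<rho> where "\<rho> = min (\<rho>0 / 2) (min \<delta> \<rho>1)"
  have \<rho>: "\<rho> > 0" "\<rho> < \<rho>0" "\<rho> \<le> \<delta>" "cball xbar \<rho> \<subseteq> U"
    using \<rho>0(1) \<delta>(1) \<rho>1 by (auto simp: \<rho>_def)
  have reg_at: "regular_constraint (\<lambda>u. G u + 0) G' UNIV K x" if "dist x xbar \<le> \<rho>" "G x \<in> K" for x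
    using \<delta>(2)[of x 0] \<delta>(1) \<rho>(3) that by simp
  define V where "V = ball xbar \<rho>"
  define \<Psi> where "\<Psi> = (\<lambda>(a, b). X_KKT f G K a b \<inter> V)"
  have xbar: "xbar \<in> \<Psi> (0, 0)"
    using local_min_stationary[of 0 xbar U 0] reg_at[of xbar] feasible_x0 U \<rho>(1)
    by (auto simp: \<Psi>_def V_def)

  have usc: "set_usc_at \<Psi> (0, 0)"
    unfolding set_usc_at_def
  proof (intro allI impI, elim conjE)
    fix O' assume O': "open O'" "\<Psi> (0, 0) \<subseteq> O'"
    show "\<exists>U. open U \<and> (0, 0) \<in> U \<and> (\<forall>p'\<in>U. \<Psi> p' \<subseteq> O')"
    proof (rule neighbourhood_by_sequences)
      fix p :: "nat \<Rightarrow> 'a \<times> 'b" assume p: "p \<longlonglongrightarrow> (0, 0)" and bad: "\<And>n. \<not> \<Psi> (p n) \<subseteq> O'"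
      define a b where "a n = fst (p n)" and "b n = snd (p n)" for n
      have ab: "a \<longlonglongrightarrow> 0" "b \<longlonglongrightarrow> 0"
        using tendsto_fst[OF p] tendsto_snd[OF p] by (simp_all add: a_def[abs_def] b_def[abs_def])
      have "\<exists>x y. (x, y) \<in> S_KKT f G K (a n) (b n) \<and> x \<in> V \<and> x \<notin> O'" for n
        using bad[of n] by (auto simp: \<Psi>_def a_def b_def X_KKT_def split: prod.splits)
      then obtain X Y where XY: "\<And>n. (X n, Y n) \<in> S_KKT f G K (a n) (b n)" "\<And>n. X n \<in> V" "\<And>n. X n \<notin> O'"
        by metis
      have "norm (X n) \<le> norm xbar + \<rho>" for n
        using XY(2)[of n] norm_triangle_sub[of "X n" xbar] by (simp add: V_def dist_norm norm_minus_commute)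
      then have "\<forall>\<^sub>F n in sequentially. norm (X n) \<le> norm xbar + \<rho>" by simp
      then obtain r x where r: "strict_mono r" and x: "(\<lambda>n. X (r n)) \<longlonglongrightarrow> x"
        by (rule eventually_bounded_convergent_subsequence)
      note sub = LIMSEQ_subseq_LIMSEQ[OF _ r, unfolded o_def]
      have "x \<in> cball xbar \<rho>"
        by (rule Lim_in_closed_set[OF closed_cball _ _ x]) (use XY(2) in \<open>auto simp: V_def less_imp_le\<close>)
      then have near: "dist x xbar \<le> \<rho>" by (simp add: dist_commute)
      have "(\<lambda>n. G (X (r n)) + b (r n)) \<longlonglongrightarrow> G x + 0"
        by (intro tendsto_add sub[OF ab(2)] isCont_tendsto_compose[OF isCont_g x]) simp
      moreover have "G (X n) + b n \<in> K" for n
        using XY(1)[of n] KKT_iff normal_cone_base by blast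
      ultimately have "G x + 0 \<in> K"
        by (intro Lim_in_closed_set[OF closed_K]) auto
      then obtain y where "(x, y) \<in> S_KKT f G K 0 0"
        using KKT_limit[OF XY(1) x sub[OF ab(1)] sub[OF ab(2)] reg_at[OF near]] by auto
      then have "x = xbar" using \<rho>0(2)[of x] near \<rho>(2) by (auto simp: X_KKT_def)
      then have "x \<in> O'" using xbar O' by auto
      moreover have "x \<in> - O'"
        by (rule Lim_in_closed_set[OF _ _ _ x]) (use O' XY(3) in auto)
      ultimately show False by simp
    qed
  qed

  have lsc: "set_lsc_at \<Psi> (0, 0) xbar"
    unfolding set_lsc_at_def
  proof (intro conjI xbar allI impI, elim conjE)
    fix O' assume O': "open O'" "xbar \<in> O'"
    obtain \<eta>0 where \<eta>0: "\<eta>0 > 0" "cball xbar \<eta>0 \<subseteq> O'" using O' open_contains_cball by blast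
    define \<eta> where "\<eta> = min \<eta>0 (\<rho> / 2)"
    have \<eta>: "\<eta> > 0" "\<eta> < \<rho>" "cball xbar \<eta> \<subseteq> O'" using \<eta>0 \<rho>(1) by (auto simp: \<eta>_def)
    obtain \<kappa> \<delta>1 where \<kappa>: "\<kappa> > 0" "\<delta>1 > 0" and mr:
      "\<And>x b. dist x xbar < \<delta>1 \<Longrightarrow> norm b < \<delta>1 \<Longrightarrow>
        \<exists>u\<in>UNIV. G u + b \<in> K \<and> dist u x \<le> \<kappa> * infdist (G x + b) K"
      using metric_regularity by metis
    show "\<exists>U. open U \<and> (0, 0) \<in> U \<and> (\<forall>p'\<in>U. \<Psi> p' \<inter> O' \<noteq> {})"
    proof (rule neighbourhood_by_sequences)
      fix p :: "nat \<Rightarrow> 'a \<times> 'b" assume p: "p \<longlonglongrightarrow> (0, 0)" and bad: "\<And>n. \<not> \<Psi> (p n) \<inter> O' \<noteq> {}"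
      define a b where "a n = fst (p n)" and "b n = snd (p n)" for n
      have ab: "a \<longlonglongrightarrow> 0" "b \<longlonglongrightarrow> 0"
        using tendsto_fst[OF p] tendsto_snd[OF p] by (simp_all add: a_def[abs_def] b_def[abs_def])
      define good where "good n \<longleftrightarrow> norm (b n) < \<delta>1 \<and> \<kappa> * norm (b n) < \<eta>" for n
      have kb: "(\<lambda>n. \<kappa> * norm (b n)) \<longlonglongrightarrow> 0"
        using tendsto_mult[OF tendsto_const tendsto_norm[OF ab(2)], of \<kappa>] by simp
      have ev_good: "\<forall>\<^sub>F n in sequentially. good n"
        unfolding good_def using tendsto_norm[OF ab(2)] \<kappa>(2)
        by (intro eventually_conj order_tendstoD[OF kb] order_tendstoD(2)[where y=0]) (use \<eta>(1) in auto)
      have "\<exists>u. G u + b n \<in> K \<and> dist u xbar \<le> \<kappa> * norm (b n)" if "good n" for n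
      proof -
        have "infdist (G xbar + b n) K \<le> norm (b n)"
          using infdist_le[OF feasible_x0, of "G xbar + b n"] by (simp add: dist_norm)
        then have "\<kappa> * infdist (G xbar + b n) K \<le> \<kappa> * norm (b n)" using \<kappa>(1) by simp
        then show ?thesis using mr[of xbar "b n"] \<kappa>(2) that by (force simp: good_def)
      qed
      then obtain u where u: "\<And>n. good n \<Longrightarrow> G (u n) + b n \<in> K"
        "\<And>n. good n \<Longrightarrow> dist (u n) xbar \<le> \<kappa> * norm (b n)" by metis
      have u_lim: "u \<longlonglongrightarrow> xbar"
        by (rule metric_tendsto_imp_tendsto[OF kb]) (use ev_good in eventually_elim, use u(2) \<kappa>(1) in auto)
      define S where "S n = cball xbar \<eta> \<inter> {x. G x + b n \<in> K}" for n
      have uS: "u n \<in> S n" if "good n" for n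
        using u[OF that] that by (auto simp: S_def good_def dist_commute)
      have "\<exists>x\<in>S n. \<forall>v\<in>S n. f x - a n \<bullet> x \<le> f v - a n \<bullet> v" if "good n" for n
      proof (rule continuous_attains_inf)
        have "closed ((\<lambda>x. G x + b n) -` K)"
          by (intro closed_vimage closed_K continuous_intros cont_g)
        then show "compact (S n)" unfolding S_def vimage_def by (intro compact_Int_closed compact_cball)
        show "S n \<noteq> {}" using uS[OF that] by auto
        show "continuous_on (S n) (\<lambda>x. f x - a n \<bullet> x)"
          using isCont_f by (intro continuous_intros continuous_at_imp_continuous_on) auto
      qed
      then obtain X where X: "\<And>n. good n \<Longrightarrow> X n \<in> S n"
        "\<And>n v. good n \<Longrightarrow> v \<in> S n \<Longrightarrow> f (X n) - a n \<bullet> X n \<le> f v - a n \<bullet> v" by metis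
      have "\<forall>\<^sub>F n in sequentially. norm (X n) \<le> norm xbar + \<eta>"
        using ev_good
      proof eventually_elim
        case (elim n)
        then show ?case using X(1)[OF elim] norm_triangle_sub[of "X n" xbar]
          by (simp add: S_def dist_norm norm_minus_commute)
      qed
      then obtain r x where r: "strict_mono r" and x: "(\<lambda>n. X (r n)) \<longlonglongrightarrow> x"
        by (rule eventually_bounded_convergent_subsequence)
      note sub = LIMSEQ_subseq_LIMSEQ[OF _ r, unfolded o_def]
      have ev_r: "\<forall>\<^sub>F n in sequentially. good (r n)"
        using filterlim_subseq[OF r] ev_good by (auto simp: filterlim_iff)
      have "x \<in> cball xbar \<eta>"
        by (rule Lim_in_closed_set[OF closed_cball _ _ x])
          (use ev_r X(1) in \<open>auto simp: S_def elim!: eventually_mono\<close>)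
      then have near: "dist x xbar < \<rho>" using \<eta>(2) by (simp add: dist_commute)
      have "(\<lambda>n. G (X (r n)) + b (r n)) \<longlonglongrightarrow> G x + 0"
        by (intro tendsto_add sub[OF ab(2)] isCont_tendsto_compose[OF isCont_g x]) simp
      then have "G x + 0 \<in> K"
        by (rule Lim_in_closed_set[OF closed_K, rotated 2])
          (use ev_r X(1) in \<open>auto simp: S_def elim!: eventually_mono\<close>)
      then have xK: "G x \<in> K" by simp
      have "f x - 0 \<bullet> x \<le> f xbar - 0 \<bullet> xbar"
      proof (rule tendsto_le)
        show "(\<lambda>n. f (X (r n)) - a (r n) \<bullet> X (r n)) \<longlonglongrightarrow> f x - 0 \<bullet> x"
          by (intro tendsto_diff tendsto_inner x sub[OF ab(1)] isCont_tendsto_compose[OF isCont_f x])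
        show "(\<lambda>n. f (u (r n)) - a (r n) \<bullet> u (r n)) \<longlonglongrightarrow> f xbar - 0 \<bullet> xbar"
          by (intro tendsto_diff tendsto_inner sub[OF u_lim] sub[OF ab(1)]
              isCont_tendsto_compose[OF isCont_f sub[OF u_lim]])
        show "\<forall>\<^sub>F n in sequentially. f (X (r n)) - a (r n) \<bullet> X (r n) \<le> f (u (r n)) - a (r n) \<bullet> u (r n)"
          using ev_r by eventually_elim (rule X(2)[OF _ uS])
      qed simp
      then have "f x \<le> f v" if "v \<in> ball xbar \<rho>" "G v \<in> K" for v
        using U(3)[OF that(2)] that(1) \<rho>(4) by (force simp: subset_iff)
      then have "x \<in> X_KKT f G K 0 0"
        using near xK by (intro local_min_stationary[of 0 x "ball xbar \<rho>"] reg_at) (auto simp: dist_commute)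
      then have x_eq: "x = xbar" using \<rho>0(2)[of x] near \<rho>(2) by simp
      have "\<forall>\<^sub>F n in sequentially. norm (b (r n)) < \<delta>"
        by (rule order_tendstoD[OF tendsto_norm[OF sub[OF ab(2)]]]) (use \<delta>(1) in simp)
      then have "\<forall>\<^sub>F n in sequentially. False"
        using ev_r tendstoD[OF x \<eta>(1)]
      proof eventually_elim
        case (elim n)
        have Xin: "X (r n) \<in> ball xbar \<eta>" using elim(3) by (simp add: x_eq dist_commute)
        have "X (r n) \<in> X_KKT f G K (a (r n)) (b (r n))"
        proof (rule local_min_stationary[OF \<delta>(2) open_ball Xin])
          show "dist (X (r n)) xbar \<le> \<delta>" using Xin \<eta> \<rho> by (simp add: dist_commute)
          show "norm (b (r n)) \<le> \<delta>" using elim(1) by simp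
          show "G (X (r n)) + b (r n) \<in> K" using X(1)[OF elim(2)] by (simp add: S_def)
          show "f (X (r n)) - a (r n) \<bullet> X (r n) \<le> f v - a (r n) \<bullet> v"
            if "v \<in> ball xbar \<eta>" "G v + b (r n) \<in> K" for v
            using that by (intro X(2)[OF elim(2)]) (auto simp: S_def)
        qed
        moreover have "X (r n) \<in> V" "X (r n) \<in> O'" using Xin \<eta> by (auto simp: V_def)
        ultimately have "X (r n) \<in> \<Psi> (p (r n)) \<inter> O'"
          by (simp add: \<Psi>_def a_def b_def case_prod_beta)
        then show False using bad by blast
      qed
      then show False by simp
    qed
  qed
  have "open V" "xbar \<in> V" using \<rho>(1) by (auto simp: V_def)
  then show ?thesis using lsc usc unfolding set_continuous_at_def \<Psi>_def by blast
qed

end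

text \<open>
  Normal vectors are nonpositive on tangent vectors, so a normal vector annihilated by the adjoint
  derivative is nonpositive on the whole space.
\<close>

lemma RCQ_dual:
  fixes K :: "'b::euclidean_space set"
  assumes rcq: "RCQ G K x" and y: "y \<in> normal_cone K (G x)"
    and 0: "\<And>h. y \<bullet> frechet_derivative G (at x) h = 0"
  shows "y = 0"
proof -
  have "y \<in> {u + v | u v. u \<in> range (frechet_derivative G (at x)) \<and> v \<in> tangent_cone K (G x)}"
    using rcq unfolding RCQ_def by simp
  then obtain h v where "y = frechet_derivative G (at x) h + v" "v \<in> tangent_cone K (G x)" by auto
  then have "y \<bullet> y \<le> 0"
    using normal_cone_polar_tangent_cone[OF y] 0 by (metis add_0 inner_add_right)
  then show ?thesis by (meson inner_gt_zero_iff not_le)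
qed

theorem theorem16:
  fixes f :: "'x::euclidean_space \<Rightarrow> real"
    and G :: "'x \<Rightarrow> 'y::euclidean_space"
    and K :: "'y set"
    and xbar :: 'x
  assumes "C2_on f UNIV" and "C2_on G UNIV"
    and "K \<noteq> {}" and "closed K" and "convex K"
    and "C2_cone_reducible K"
    and "locally_optimal f G K 0 0 xbar"
    and "RCQ G K xbar"
    and "robinson_SOSC f G K xbar"
  shows "\<exists>V. open V \<and> xbar \<in> V \<and>
    set_continuous_at (\<lambda>(a, b). X_KKT f G K a b \<inter> V) (0, 0) xbar"
proof -
  obtain f' f'' where f: "\<And>x. (f has_derivative blinfun_apply (f' x)) (at x)"
    "\<And>x. (f' has_derivative blinfun_apply (f'' x)) (at x)" "continuous_on UNIV f''"
    using assms(1) unfolding C2_on_def by blast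
  obtain G' G'' where G: "\<And>x. (G has_derivative blinfun_apply (G' x)) (at x)"
    "\<And>x. (G' has_derivative blinfun_apply (G'' x)) (at x)" "continuous_on UNIV G''"
    using assms(2) unfolding C2_on_def by blast
  have feas: "G xbar \<in> K" using assms(7) by (simp add: locally_optimal_def feasible_def)
  interpret regular_problem G G' K xbar f f'
  proof
    show "continuous_on UNIV f'" "continuous_on UNIV G'"
      using f(2) G(2) has_derivative_continuous by (blast intro: continuous_at_imp_continuous_on)+
    fix y assume "y \<in> normal_cone K (G xbar)" "\<And>h. y \<bullet> G' xbar h = 0"
    then show "y = 0"
      using RCQ_dual[OF assms(8)] frechet_derivative_at[OF G(1)] by metis
  qed (use f G assms feas in auto)
  show ?thesis
  proof (intro stationary_points_continuous stationary_point_isolated)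
    show "C2_cone_reducible_at K (G xbar)"
      using assms(6) feas by (simp add: C2_cone_reducible_def)
  qed (fact f G assms)+
qed

end
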